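(* Let $\phi\in L^\infty$ and let $\eta,\theta$ be two inner functions with $\theta$ non-constant. Then: (i) the restricted Toeplitz operator $\mathcal{T}_\phi:\eta H^2\to K_\theta$ is zero if and only if $\phi\in\bar\eta\theta H^\infty$; (ii) the restricted Hankel operator $\mathcal{H}_\phi:\eta H^2\to K_\theta$ is zero if and only if $\phi\in\bar\eta H^\infty$.
   Context: $H^2$ is the Hardy space, viewed as a closed subspace of $L^2=L^2(\mathbb{T})$; $L^\infty=L^\infty(\mathbb{T})$; $H^\infty=L^\infty\cap H^2$. For an inner function $\theta$, $K_\theta=H^2\ominus\theta H^2$ is the model space and $P_\theta:L^2\to K_\theta$ the orthogonal projection. The flip operator $\mathcal{J}:L^2\to L^2$ is $(\mathcal{J}f)(\xi)=\bar\xi f(\bar\xi)$, $\xi\in\mathbb{T}$. For $\phi\in L^\infty$ and inner functions $\eta,\theta$: $\mathcal{T}_\phi:\eta H^2\to K_\theta$, $\mathcal{T}_\phi(h)=P_\theta(\phi h)$, and $\mathcal{H}_\phi:\eta H^2\to K_\theta$, $\mathcal{H}_\phi(h)=P_\theta\mathcal{J}(\phi h)$. *)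

theory Defs
  imports "HOL-Analysis.Analysis"
begin

text \<open>
  Functions on the unit circle are modelled by functions on \<^typ>\<open>complex\<close>, considered modulo
  equality almost everywhere with respect to normalised arc length; values off the circle are
  irrelevant, since the measure is concentrated on the circle.  All function spaces below are
  sets of representatives closed under almost everywhere equality of measurable functions.
\<close>

definition circle :: "complex measure" where
  "circle = distr (uniform_measure lborel {0..2 * pi}) borel cis"

definition L2 :: "(complex \<Rightarrow> complex) set" where
  "L2 = {f \<in> borel_measurable circle. integrable circle (\<lambda>z. (cmod (f z))\<^sup>2)}"

definition Linf :: "(complex \<Rightarrow> complex) set" where
  "Linf = {f \<in> borel_measurable circle. \<exists>C. AE z in circle. cmod (f z) \<le> C}"

definition L2_inner :: "(complex \<Rightarrow> complex) \<Rightarrow> (complex \<Rightarrow> complex) \<Rightarrow> complex" where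
  "L2_inner f g = (LINT z|circle. f z * cnj (g z))"

definition fourier_coeff :: "(complex \<Rightarrow> complex) \<Rightarrow> int \<Rightarrow> complex" where
  "fourier_coeff f n = L2_inner f (\<lambda>z. z powi n)"

definition H2 :: "(complex \<Rightarrow> complex) set" where
  "H2 = {f \<in> L2. \<forall>n<0. fourier_coeff f n = 0}"

definition Hinf :: "(complex \<Rightarrow> complex) set" where
  "Hinf = Linf \<inter> H2"

definition inner_function :: "(complex \<Rightarrow> complex) \<Rightarrow> bool" where
  "inner_function \<theta> \<longleftrightarrow> \<theta> \<in> Hinf \<and> (AE z in circle. cmod (\<theta> z) = 1)"

definition ae_constant :: "(complex \<Rightarrow> complex) \<Rightarrow> bool" where
  "ae_constant f \<longleftrightarrow> (\<exists>c. AE z in circle. f z = c)"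

text \<open>The set \<open>u S\<close> of products \<open>u g\<close> with \<open>g\<close> in \<open>S\<close>, closed under almost everywhere equality.\<close>

definition mult_set ::
  "(complex \<Rightarrow> complex) \<Rightarrow> (complex \<Rightarrow> complex) set \<Rightarrow> (complex \<Rightarrow> complex) set" where
  "mult_set u S = {f \<in> borel_measurable circle. \<exists>g\<in>S. AE z in circle. f z = u z * g z}"

definition model_space :: "(complex \<Rightarrow> complex) \<Rightarrow> (complex \<Rightarrow> complex) set" where
  "model_space \<theta> = {f \<in> H2. \<forall>g\<in>mult_set \<theta> H2. L2_inner f g = 0}"

text \<open>
  The orthogonal projection of \<open>f \<in> L2\<close> onto a closed subspace \<open>M\<close> is determined only up to
  almost everywhere equality, hence the choice of a representative.
\<close>

definition orth_proj ::
  "(complex \<Rightarrow> complex) set \<Rightarrow> (complex \<Rightarrow> complex) \<Rightarrow> complex \<Rightarrow> complex" where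
  "orth_proj M f = (SOME g. g \<in> M \<and> (\<forall>k\<in>M. L2_inner (\<lambda>z. f z - g z) k = 0))"

definition flip :: "(complex \<Rightarrow> complex) \<Rightarrow> complex \<Rightarrow> complex" where
  "flip f = (\<lambda>z. cnj z * f (cnj z))"

definition restricted_toeplitz ::
  "(complex \<Rightarrow> complex) \<Rightarrow> (complex \<Rightarrow> complex) \<Rightarrow> (complex \<Rightarrow> complex) \<Rightarrow>
   (complex \<Rightarrow> complex) \<Rightarrow> complex \<Rightarrow> complex" where
  "restricted_toeplitz \<eta> \<theta> \<phi> =
     (\<lambda>h\<in>mult_set \<eta> H2. orth_proj (model_space \<theta>) (\<lambda>z. \<phi> z * h z))"

definition restricted_hankel ::
  "(complex \<Rightarrow> complex) \<Rightarrow> (complex \<Rightarrow> complex) \<Rightarrow> (complex \<Rightarrow> complex) \<Rightarrow>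
   (complex \<Rightarrow> complex) \<Rightarrow> complex \<Rightarrow> complex" where
  "restricted_hankel \<eta> \<theta> \<phi> =
     (\<lambda>h\<in>mult_set \<eta> H2. orth_proj (model_space \<theta>) (flip (\<lambda>z. \<phi> z * h z)))"

definition zero_operator_on ::
  "(complex \<Rightarrow> complex) set \<Rightarrow> ((complex \<Rightarrow> complex) \<Rightarrow> complex \<Rightarrow> complex) \<Rightarrow> bool" where
  "zero_operator_on D A \<longleftrightarrow> (\<forall>h\<in>D. AE z in circle. A h z = 0)"

end

theory Submission
  imports Defs
begin

text \<open>
  Vanishing of either operator means that \<open>\<phi> \<eta> z\<^sup>n\<close>, respectively its flip, is orthogonal to \<open>K\<^sub>\<theta>\<close> for
  all \<open>n \<ge> 0\<close>.  Put \<open>f = \<phi> \<eta>\<close> and let \<open>t\<close> be the mean of \<open>\<theta>\<close>; as \<open>\<theta>\<close> is not constant, \<open>\<bar>t\<bar> < 1\<close>.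
  In the Toeplitz case, testing against the two elements \<open>1 - cnj t \<theta>\<close> and \<open>cnj z (\<theta> - t)\<close> of \<open>K\<^sub>\<theta>\<close>
  relates the \<open>n\<close>-th coefficients \<open>F\<close> of \<open>f\<close> and \<open>U\<close> of \<open>cnj \<theta> f\<close>, for \<open>n < 0\<close>, by \<open>F = t U\<close> and
  \<open>U = cnj t F\<close>, so \<open>U = 0\<close>.  In the Hankel case \<open>1 - cnj t \<theta>\<close> alone suffices, because \<open>\<bar>t\<bar> < 1\<close> makes
  it invertible in \<open>H\<^sup>\<infinity>\<close>.

  The operators are defined by choosing a projection, so its existence is needed even to read off
  orthogonality; this rests on the completeness of \<open>L\<^sup>2\<close>.
\<close>

section \<open>Normalised arc length\<close>

lemma sets_circle [simp, measurable_cong]: "sets circle = sets borel"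
  by (simp add: circle_def)

lemma space_circle [simp]: "space circle = UNIV"
  by (simp add: circle_def)

lemma measurable_cis [measurable]: "cis \<in> borel_measurable borel"
  by (intro borel_measurable_continuous_onI continuous_intros)

lemma measurable_cnj [measurable]: "cnj \<in> borel_measurable borel"
  by (intro borel_measurable_continuous_onI continuous_intros)

lemma measurable_power_int_circle [measurable]:
  fixes n :: int
  shows "(\<lambda>z::complex. z powi n) \<in> borel_measurable borel"
  unfolding power_int_def by (cases "n \<ge> 0") auto

lemma nn_integral_circle:
  assumes [measurable]: "f \<in> borel_measurable borel"
  shows "(\<integral>\<^sup>+z. f z \<partial>circle) =
    (\<integral>\<^sup>+t. f (cis t) * indicator {0..2 * pi} t \<partial>lborel) / ennreal (2 * pi)"
proof -
  have "(\<integral>\<^sup>+z. f z \<partial>circle) = (\<integral>\<^sup>+t. f (cis t) \<partial>uniform_measure lborel {0..2 * pi})"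
    unfolding circle_def by (subst nn_integral_distr) auto
  also have "\<dots> = (\<integral>\<^sup>+t. f (cis t) * indicator {0..2 * pi} t \<partial>lborel) / ennreal (2 * pi)"
    by (subst nn_integral_uniform_measure) auto
  finally show ?thesis .
qed

lemma emeasure_circle_UNIV: "emeasure circle UNIV = 1"
proof -
  have "emeasure circle UNIV = (\<integral>\<^sup>+z. 1 \<partial>circle)"
    by simp
  also have "\<dots> = 1"
    by (subst nn_integral_circle) (auto simp: ennreal_divide_self simp del: nn_integral_const)
  finally show ?thesis .
qed

interpretation circle: finite_measure circle
  by standard (simp add: emeasure_circle_UNIV)

lemma measure_circle_UNIV [simp]: "measure circle UNIV = 1"
  by (simp add: measure_def emeasure_circle_UNIV)

lemma AE_circle_cmod: "AE z in circle. cmod z = 1"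
  unfolding circle_def by (subst AE_distr_iff) auto

lemma integral_circle:
  fixes f :: "complex \<Rightarrow> 'a::{banach, second_countable_topology}"
  assumes [measurable]: "f \<in> borel_measurable borel"
  shows "(LINT z|circle. f z) =
    (LINT t|lborel. indicator {0..2 * pi} t *\<^sub>R f (cis t)) /\<^sub>R (2 * pi)"
proof -
  \<comment> \<open>Written as a density over Lebesgue measure, the uniform measure falls under
    \<open>integral_density\<close>.\<close>
  have *: "uniform_measure lborel {0..2 * pi} =
      density lborel (\<lambda>t. ennreal (indicator {0..2 * pi} t / (2 * pi)))"
    unfolding uniform_measure_def
    by (intro density_cong) (auto simp: indicator_def simp flip: divide_ennreal)
  have "(LINT z|circle. f z) = (LINT t|uniform_measure lborel {0..2 * pi}. f (cis t))"
    unfolding circle_def by (subst integral_distr) auto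
  also have "\<dots> = (LINT t|lborel. (indicator {0..2 * pi} t / (2 * pi)) *\<^sub>R f (cis t))"
    unfolding * by (subst integral_density) auto
  also have "\<dots> = (LINT t|lborel. inverse (2 * pi) *\<^sub>R (indicator {0..2 * pi} t *\<^sub>R f (cis t)))"
    by (simp add: field_simps)
  finally show ?thesis
    by (simp del: scaleR_scaleR)
qed

text \<open>In terms of the angle, conjugation is the reflection t -> 2 pi - t of [0, 2 pi], which
  preserves Lebesgue measure. This invariance controls the flip, both on \<open>L2\<close> and on
  Fourier coefficients.\<close>

lemma distr_circle_cnj: "distr circle borel cnj = circle"
proof (rule measure_eqI)
  fix A assume "A \<in> sets (distr circle borel cnj)"
  then have [measurable]: "A \<in> sets borel" by simp
  let ?f = "indicator A :: complex \<Rightarrow> ennreal"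
  have "emeasure (distr circle borel cnj) A = (\<integral>\<^sup>+z. ?f z \<partial>distr circle borel cnj)"
    by simp
  also have "\<dots> = (\<integral>\<^sup>+z. ?f (cnj z) \<partial>circle)"
    by (rule nn_integral_distr) auto
  also have "\<dots> = (\<integral>\<^sup>+t. ?f (cnj (cis t)) * indicator {0..2 * pi} t \<partial>lborel) / ennreal (2 * pi)"
    by (rule nn_integral_circle) auto
  also have "(\<integral>\<^sup>+t. ?f (cnj (cis t)) * indicator {0..2 * pi} t \<partial>lborel) =
      (\<integral>\<^sup>+t. ?f (cnj (cis (2 * pi + (-1) * t))) * indicator {0..2 * pi} (2 * pi + (-1) * t) \<partial>lborel)"
    by (subst nn_integral_real_affine[where c = "-1" and t = "2 * pi"]) auto
  also have "\<dots> = (\<integral>\<^sup>+t. ?f (cis t) * indicator {0..2 * pi} t \<partial>lborel)"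
  proof -
    have 1: "cnj (cis (2 * pi + (-1) * t)) = cis t" for t
      by (simp add: complex_eq_iff sin_diff cos_diff)
    have 2: "indicator {0..2 * pi} (2 * pi + (-1) * t) = (indicator {0..2 * pi} t :: ennreal)" for t
      by (auto simp: indicator_def)
    show ?thesis unfolding 1 2 ..
  qed
  also have "\<dots> / ennreal (2 * pi) = emeasure circle A"
    by (subst nn_integral_circle[symmetric]) auto
  finally show "emeasure (distr circle borel cnj) A = emeasure circle A" .
qed auto

lemma integral_circle_cnj:
  fixes f :: "complex \<Rightarrow> 'a::{banach, second_countable_topology}"
  assumes [measurable]: "f \<in> borel_measurable borel"
  shows "(LINT z|circle. f (cnj z)) = (LINT z|circle. f z)"
  by (subst (2) distr_circle_cnj[symmetric]) (simp add: integral_distr)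

text \<open>For \<open>n \<noteq> 0\<close> the integrand has an antiderivative in the angle that
  takes equal values at 0 and 2 pi. This is the orthonormality of the powers of
  \<open>z\<close>.\<close>

lemma integral_circle_powi: "(LINT z|circle. z powi n) = (if n = 0 then 1 else 0)"
proof (cases "n = 0")
  case False
  let ?F = "\<lambda>t::real. cis (of_int n * t) / (\<i> * of_int n)"
  have "(LINT t|lborel. indicator {0..2 * pi} t *\<^sub>R cis (of_int n * t)) = ?F (2 * pi) - ?F 0"
  proof (rule integral_FTC_atLeastAtMost)
    show "(?F has_vector_derivative cis (of_int n * t)) (at t within {0..2 * pi})" for t
      using False
      by (auto simp: cis_conv_exp mult.assoc mult.commute[of "exp _"] simp flip: mult.assoc[of \<i> \<i>]
          intro!: derivative_eq_intros has_vector_derivative_real_field)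
  qed (auto intro!: continuous_intros)
  moreover have "cis (of_int n * (2 * pi)) = 1"
    by (metis cis_multiple_2pi Ints_of_int mult.commute mult.left_commute)
  ultimately show ?thesis
    using False by (simp add: integral_circle cis_power_int)
qed simp

section \<open>The Hilbert space of square-integrable functions\<close>

text \<open>The norm is kept squared so that Cauchy-Schwarz, Bessel and completeness can be stated
  without roots.\<close>

definition sqnorm :: "(complex \<Rightarrow> complex) \<Rightarrow> real" where
  "sqnorm f = (LINT z|circle. (cmod (f z))\<^sup>2)"

lemma borel_measurable_circle: "borel_measurable circle = borel_measurable borel"
  by (rule measurable_cong_sets) auto

lemma L2_measurable [measurable_dest]: "f \<in> L2 \<Longrightarrow> f \<in> borel_measurable borel"
  by (simp add: L2_def borel_measurable_circle)

lemma Linf_measurable [measurable_dest]: "f \<in> Linf \<Longrightarrow> f \<in> borel_measurable borel"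
  by (simp add: Linf_def borel_measurable_circle)

lemma L2_integrable_sq: "f \<in> L2 \<Longrightarrow> integrable circle (\<lambda>z. (cmod (f z))\<^sup>2)"
  by (simp add: L2_def)

lemma L2I:
  assumes "f \<in> borel_measurable borel" "integrable circle (\<lambda>z. (cmod (f z))\<^sup>2)"
  shows "f \<in> L2"
  using assms by (simp add: L2_def borel_measurable_circle)

text \<open>Domination criterion behind most closure properties of \<open>L2\<close> below: a.e.
  modification, scalar multiples, conjugation and bounded multipliers are all instances.\<close>

lemma L2_bounded_by:
  assumes "f \<in> L2" and [measurable]: "g \<in> borel_measurable borel"
    and "AE z in circle. cmod (g z) \<le> C * cmod (f z)"
  shows "g \<in> L2"
proof (rule L2I)
  show "integrable circle (\<lambda>z. (cmod (g z))\<^sup>2)"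
  proof (rule Bochner_Integration.integrable_bound)
    show "integrable circle (\<lambda>z. C\<^sup>2 * (cmod (f z))\<^sup>2)"
      using L2_integrable_sq[OF assms(1)] by simp
    show "AE z in circle. norm ((cmod (g z))\<^sup>2) \<le> norm (C\<^sup>2 * (cmod (f z))\<^sup>2)"
      using assms(3)
    proof eventually_elim
      case (elim z)
      then have "(cmod (g z))\<^sup>2 \<le> (C * cmod (f z))\<^sup>2"
        by (intro power_mono) auto
      then show ?case by (simp add: power_mult_distrib)
    qed
  qed (measurable)
qed (fact)

lemma L2_cong_AE:
  assumes "f \<in> L2" "g \<in> borel_measurable borel" "AE z in circle. g z = f z"
  shows "g \<in> L2"
  by (rule L2_bounded_by[OF assms(1,2), of 1]) (use assms(3) in auto)

lemma L2_add:
  assumes [measurable]: "f \<in> L2" "g \<in> L2"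
  shows "(\<lambda>z. f z + g z) \<in> L2"
proof (rule L2I)
  show "integrable circle (\<lambda>z. (cmod (f z + g z))\<^sup>2)"
  proof (rule Bochner_Integration.integrable_bound)
    show "integrable circle (\<lambda>z. 2 * (cmod (f z))\<^sup>2 + 2 * (cmod (g z))\<^sup>2)"
      using L2_integrable_sq[OF assms(1)] L2_integrable_sq[OF assms(2)] by simp
    have "(cmod (f z + g z))\<^sup>2 \<le> 2 * (cmod (f z))\<^sup>2 + 2 * (cmod (g z))\<^sup>2" for z
    proof -
      have "(cmod (f z + g z))\<^sup>2 \<le> (cmod (f z) + cmod (g z))\<^sup>2"
        by (intro power_mono norm_triangle_ineq) auto
      also have "\<dots> \<le> 2 * (cmod (f z))\<^sup>2 + 2 * (cmod (g z))\<^sup>2"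
        using sum_squares_bound[of "cmod (f z)" "cmod (g z)"] by (simp add: power2_sum)
      finally show ?thesis .
    qed
    then show "AE z in circle. norm ((cmod (f z + g z))\<^sup>2) \<le>
        norm (2 * (cmod (f z))\<^sup>2 + 2 * (cmod (g z))\<^sup>2)"
      by (auto intro!: always_eventually)
  qed measurable
qed measurable

lemma L2_cmult: "f \<in> L2 \<Longrightarrow> (\<lambda>z. c * f z) \<in> L2"
  by (rule L2_bounded_by[of f _ "cmod c"]) (auto simp: norm_mult dest: L2_measurable)

lemma L2_diff: "f \<in> L2 \<Longrightarrow> g \<in> L2 \<Longrightarrow> (\<lambda>z. f z - g z) \<in> L2"
  using L2_add[of f "\<lambda>z. - 1 * g z"] L2_cmult[of g "-1"] by simp

lemma L2_cnj:
  assumes [measurable]: "f \<in> L2"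
  shows "(\<lambda>z. cnj (f z)) \<in> L2"
  by (rule L2_bounded_by[OF assms, of _ 1]) auto

lemma LinfE:
  assumes "f \<in> Linf"
  obtains C where "AE z in circle. cmod (f z) \<le> C"
  using assms by (auto simp: Linf_def)

lemma LinfI:
  assumes "f \<in> borel_measurable borel" "AE z in circle. cmod (f z) \<le> C"
  shows "f \<in> Linf"
  using assms by (auto simp: Linf_def borel_measurable_circle)

lemma Linf_mult_L2:
  assumes [measurable]: "f \<in> Linf" "g \<in> L2"
  shows "(\<lambda>z. f z * g z) \<in> L2"
proof -
  obtain C where "AE z in circle. cmod (f z) \<le> C"
    using assms(1) by (rule LinfE)
  then have "AE z in circle. cmod (f z * g z) \<le> C * cmod (g z)"
    by eventually_elim (simp add: norm_mult mult_right_mono)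
  then show ?thesis
    by (rule L2_bounded_by[OF assms(2), rotated]) measurable
qed

lemma L2_one: "(\<lambda>z. 1) \<in> L2"
  by (rule L2I) auto

lemma Linf_imp_L2: "f \<in> Linf \<Longrightarrow> f \<in> L2"
  using Linf_mult_L2[OF _ L2_one] by simp

lemma Linf_mult:
  assumes [measurable]: "f \<in> Linf" "g \<in> Linf"
  shows "(\<lambda>z. f z * g z) \<in> Linf"
proof -
  obtain C D where *: "AE z in circle. cmod (f z) \<le> C" "AE z in circle. cmod (g z) \<le> D"
    using assms by (metis LinfE)
  have "AE z in circle. cmod (f z * g z) \<le> C * D"
    using *
  proof eventually_elim
    case (elim z)
    then show ?case
      unfolding norm_mult by (intro mult_mono order_trans[OF norm_ge_zero elim(1)]) auto
  qed
  then show ?thesis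
    by (rule LinfI[rotated]) measurable
qed

lemma Linf_cnj:
  assumes [measurable]: "f \<in> Linf"
  shows "(\<lambda>z. cnj (f z)) \<in> Linf"
proof -
  obtain C where "AE z in circle. cmod (f z) \<le> C"
    using assms by (rule LinfE)
  then show ?thesis
    by (intro LinfI[of _ C]) auto
qed

lemma Linf_const: "(\<lambda>z. c) \<in> Linf"
  by (rule LinfI[where C = "cmod c"]) auto

lemma Linf_powi: "(\<lambda>z. z powi n) \<in> Linf"
  by (rule LinfI[where C = 1]) (use AE_circle_cmod in \<open>auto simp: norm_power_int\<close>)

lemma L2_powi: "(\<lambda>z. z powi n) \<in> L2"
  by (rule Linf_imp_L2[OF Linf_powi])

section \<open>Integrability of products and sesquilinearity of the inner product\<close>

lemma L2_mult_integrable: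
  assumes [measurable]: "f \<in> L2" "g \<in> L2"
  shows "integrable circle (\<lambda>z. f z * g z)"
proof (rule Bochner_Integration.integrable_bound)
  show "integrable circle (\<lambda>z. (cmod (f z))\<^sup>2 + (cmod (g z))\<^sup>2)"
    using L2_integrable_sq[OF assms(1)] L2_integrable_sq[OF assms(2)] by simp
  have "cmod (f z) * cmod (g z) \<le> (cmod (f z))\<^sup>2 + (cmod (g z))\<^sup>2" for z
  proof -
    have "2 * cmod (f z) * cmod (g z) \<le> (cmod (f z))\<^sup>2 + (cmod (g z))\<^sup>2"
      by (rule sum_squares_bound)
    moreover have "0 \<le> cmod (f z) * cmod (g z)"
      by simp
    ultimately show ?thesis by linarith
  qed
  then show "AE z in circle. norm (f z * g z) \<le> norm ((cmod (f z))\<^sup>2 + (cmod (g z))\<^sup>2)"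
    by (auto simp: norm_mult intro!: always_eventually)
qed measurable

lemma L2_inner_integrable: "f \<in> L2 \<Longrightarrow> g \<in> L2 \<Longrightarrow> integrable circle (\<lambda>z. f z * cnj (g z))"
  by (rule L2_mult_integrable[OF _ L2_cnj])

lemma L2_integrable: "f \<in> L2 \<Longrightarrow> integrable circle f"
  using L2_mult_integrable[OF _ L2_one] by simp

lemma L2_inner_add_left:
  "f \<in> L2 \<Longrightarrow> g \<in> L2 \<Longrightarrow> h \<in> L2 \<Longrightarrow> L2_inner (\<lambda>z. f z + g z) h = L2_inner f h + L2_inner g h"
  by (simp add: L2_inner_def distrib_right L2_inner_integrable)

lemma L2_inner_diff_left:
  "f \<in> L2 \<Longrightarrow> g \<in> L2 \<Longrightarrow> h \<in> L2 \<Longrightarrow> L2_inner (\<lambda>z. f z - g z) h = L2_inner f h - L2_inner g h"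
  by (simp add: L2_inner_def left_diff_distrib L2_inner_integrable)

lemma L2_inner_cmult_left: "L2_inner (\<lambda>z. c * f z) h = c * L2_inner f h"
  by (simp add: L2_inner_def mult.assoc)

lemma L2_inner_commute: "L2_inner g f = cnj (L2_inner f g)"
proof -
  have "cnj (L2_inner f g) = (LINT z|circle. cnj (f z * cnj (g z)))"
    unfolding L2_inner_def by (rule Bochner_Integration.integral_cnj[symmetric])
  then show ?thesis
    by (simp only: L2_inner_def complex_cnj_mult complex_cnj_cnj mult.commute)
qed

lemma L2_inner_diff_right:
  "f \<in> L2 \<Longrightarrow> g \<in> L2 \<Longrightarrow> h \<in> L2 \<Longrightarrow> L2_inner h (\<lambda>z. f z - g z) = L2_inner h f - L2_inner h g"
  by (simp add: L2_inner_def right_diff_distrib L2_inner_integrable)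

lemma L2_inner_cmult_right: "L2_inner h (\<lambda>z. c * f z) = cnj c * L2_inner h f"
  by (simp add: L2_inner_def mult.left_commute)

lemma L2_inner_sum_left:
  assumes "\<And>i. i \<in> I \<Longrightarrow> f i \<in> L2" "h \<in> L2"
  shows "L2_inner (\<lambda>z. \<Sum>i\<in>I. f i z) h = (\<Sum>i\<in>I. L2_inner (f i) h)"
  using assms by (simp add: L2_inner_def sum_distrib_right L2_inner_integrable)

lemma L2_inner_cong_AE:
  assumes [measurable]: "f \<in> borel_measurable borel" "f' \<in> borel_measurable borel"
    "g \<in> borel_measurable borel" "g' \<in> borel_measurable borel"
    and "AE z in circle. f z * cnj (g z) = f' z * cnj (g' z)"
  shows "L2_inner f g = L2_inner f' g'"
  unfolding L2_inner_def by (rule integral_cong_AE) (use assms(5) in auto)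

lemma L2_zero: "(\<lambda>z. 0) \<in> L2"
  by (rule L2I) auto

lemma L2_sum: "(\<And>i. i \<in> I \<Longrightarrow> f i \<in> L2) \<Longrightarrow> (\<lambda>z. \<Sum>i\<in>I. f i z) \<in> L2"
  by (induction I rule: infinite_finite_induct) (auto intro: L2_add L2_zero)

section \<open>Norm, Cauchy-Schwarz inequality and completeness\<close>

lemma L2_inner_self: "f \<in> L2 \<Longrightarrow> L2_inner f f = of_real (sqnorm f)"
  unfolding L2_inner_def sqnorm_def
  by (subst integral_complex_of_real[symmetric]) (simp only: of_real_power flip: complex_norm_square)

lemma sqnorm_nonneg: "0 \<le> sqnorm f"
  by (simp add: sqnorm_def)

lemma sqnorm_eq_0_imp:
  assumes "f \<in> L2" "sqnorm f = 0"
  shows "AE z in circle. f z = 0"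
proof -
  have "AE z in circle. (cmod (f z))\<^sup>2 = 0"
    using assms L2_integrable_sq[OF assms(1)]
    by (subst integral_nonneg_eq_0_iff_AE[symmetric]) (auto simp: sqnorm_def)
  then show ?thesis by simp
qed

lemma nn_integral_sq: "f \<in> L2 \<Longrightarrow> (\<integral>\<^sup>+z. ennreal ((cmod (f z))\<^sup>2) \<partial>circle) = ennreal (sqnorm f)"
  unfolding sqnorm_def by (rule nn_integral_eq_integral[OF L2_integrable_sq]) auto

text \<open>The inequality is inherited from nonnegative integrals. Absolute values stay inside the
  integral so that the case \<open>g = 1\<close> bounds the mean of the modulus, as the completeness
  proof requires.\<close>

lemma L2_Cauchy_Schwarz_abs:
  assumes [measurable]: "f \<in> L2" "g \<in> L2"
  shows "(LINT z|circle. cmod (f z) * cmod (g z))\<^sup>2 \<le> sqnorm f * sqnorm g"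
proof -
  let ?I = "LINT z|circle. cmod (f z) * cmod (g z)"
  have int: "integrable circle (\<lambda>z. cmod (f z) * cmod (g z))"
    using integrable_norm[OF L2_mult_integrable[OF assms]] by (simp add: norm_mult)
  have "ennreal (?I\<^sup>2) = (\<integral>\<^sup>+z. ennreal (cmod (f z)) * ennreal (cmod (g z)) \<partial>circle)\<^sup>2"
    using nn_integral_eq_integral[OF int] by (simp add: ennreal_mult flip: ennreal_power)
  also have "\<dots> \<le> (\<integral>\<^sup>+z. ennreal (cmod (f z)) ^ 2 \<partial>circle) * (\<integral>\<^sup>+z. ennreal (cmod (g z)) ^ 2 \<partial>circle)"
    by (rule Cauchy_Schwarz_nn_integral) measurable
  also have "\<dots> = ennreal (sqnorm f * sqnorm g)"
    by (simp add: ennreal_power nn_integral_sq assms ennreal_mult sqnorm_nonneg)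
  finally show ?thesis
    by (simp add: sqnorm_nonneg)
qed

lemma L2_Cauchy_Schwarz:
  assumes "f \<in> L2" "g \<in> L2"
  shows "(cmod (L2_inner f g))\<^sup>2 \<le> sqnorm f * sqnorm g"
proof -
  have "cmod (L2_inner f g) \<le> (LINT z|circle. cmod (f z) * cmod (g z))"
    unfolding L2_inner_def using integral_norm_bound[of circle "\<lambda>z. f z * cnj (g z)"]
    by (simp add: norm_mult)
  then have "(cmod (L2_inner f g))\<^sup>2 \<le> (LINT z|circle. cmod (f z) * cmod (g z))\<^sup>2"
    by (intro power_mono) auto
  then show ?thesis
    using L2_Cauchy_Schwarz_abs[OF assms] by linarith
qed

text \<open>Cauchy-Schwarz makes the inner product continuous in its first argument. This carries
  Fourier coefficients and orthogonality from partial sums over to their limit.\<close>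

lemma L2_inner_tendsto:
  assumes "\<And>n. u n \<in> L2" "g \<in> L2" "h \<in> L2"
    and lim: "(\<lambda>n. sqnorm (\<lambda>z. g z - u n z)) \<longlonglongrightarrow> 0"
  shows "(\<lambda>n. L2_inner (u n) h) \<longlonglongrightarrow> L2_inner g h"
proof -
  have "(\<lambda>n. (cmod (L2_inner (\<lambda>z. g z - u n z) h))\<^sup>2) \<longlonglongrightarrow> 0"
  proof (rule tendsto_sandwich[OF _ _ tendsto_const])
    show "(\<lambda>n. sqnorm (\<lambda>z. g z - u n z) * sqnorm h) \<longlonglongrightarrow> 0"
      using tendsto_mult_left_zero[OF lim] .
  qed (auto intro!: always_eventually L2_Cauchy_Schwarz L2_diff assms)
  then have "(\<lambda>n. L2_inner (\<lambda>z. g z - u n z) h) \<longlonglongrightarrow> 0"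
    by (simp add: tendsto_norm_zero_iff)
  then have "(\<lambda>n. L2_inner g h - L2_inner (u n) h) \<longlonglongrightarrow> 0"
    by (simp add: L2_inner_diff_left assms)
  then have "(\<lambda>n. - (L2_inner g h - L2_inner (u n) h) + L2_inner g h) \<longlonglongrightarrow> - 0 + L2_inner g h"
    by (intro tendsto_intros)
  then show ?thesis by simp
qed

text \<open>Riesz-Fischer argument: over a measure of total mass 1 an L2-Cauchy sequence is
  L1-Cauchy, so a subsequence converges a.e.; Fatou's lemma then gives L2 convergence of the whole
  sequence to that limit.\<close>

lemma L2_complete:
  assumes u: "\<And>n. u n \<in> L2"
    and Cauchy: "\<And>e. e > 0 \<Longrightarrow> \<exists>N. \<forall>i\<ge>N. \<forall>j\<ge>N. sqnorm (\<lambda>z. u i z - u j z) < e"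
  obtains g where "g \<in> L2" "(\<lambda>n. sqnorm (\<lambda>z. g z - u n z)) \<longlonglongrightarrow> 0"
proof -
  have [measurable]: "u n \<in> borel_measurable borel" for n
    using u by (rule L2_measurable)
  have L1: "(LINT z|circle. cmod (u i z - u j z))\<^sup>2 \<le> sqnorm (\<lambda>z. u i z - u j z)" for i j
    using L2_Cauchy_Schwarz_abs[OF L2_diff[OF u u] L2_one, of i j] by (simp add: sqnorm_def)
  obtain r where r: "strict_mono r" "AE z in circle. Cauchy (\<lambda>i. u (r i) z)"
  proof (rule cauchy_L1_AE_cauchy_subseq[of circle u])
    fix e :: real assume "e > 0"
    \<comment> \<open>The tolerance is squared because \<open>L1\<close> bounds the square of the
      integral by \<open>sqnorm\<close>.\<close>
    then obtain N where N: "\<forall>i\<ge>N. \<forall>j\<ge>N. sqnorm (\<lambda>z. u i z - u j z) < e\<^sup>2"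
      using Cauchy[of "e\<^sup>2"] by auto
    have "(LINT z|circle. cmod (u i z - u j z)) < e" if "i \<ge> N" "j \<ge> N" for i j
    proof -
      have "(LINT z|circle. cmod (u i z - u j z))\<^sup>2 < e\<^sup>2"
        using L1[of i j] N that by (metis order_le_less_trans)
      then show ?thesis
        using \<open>e > 0\<close> by (simp add: power2_less_imp_less)
    qed
    then show "\<exists>N. \<forall>i\<ge>N. \<forall>j\<ge>N. (LINT z|circle. norm (u i z - u j z)) < e"
      by blast
  qed (auto intro: L2_integrable u)
  define g where "g = (\<lambda>z. lim (\<lambda>i. u (r i) z))"
  have [measurable]: "g \<in> borel_measurable borel"
    unfolding g_def by measurable
  have lim: "AE z in circle. (\<lambda>i. u (r i) z) \<longlonglongrightarrow> g z"
    using r(2) by eventually_elim (simp add: g_def Cauchy_convergent_iff convergent_LIMSEQ_iff)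
  \<comment> \<open>Fatou along the subsequence with \<open>n\<close> fixed: \<open>u (r i)\<close>
    tends to \<open>g\<close> a.e., and eventually \<open>N \<le> r i\<close>. As \<open>g\<close>
    is not yet known to be in \<open>L2\<close>, the integral is taken in
    \<open>ennreal\<close>.\<close>
  have bound: "(\<integral>\<^sup>+z. ennreal ((cmod (g z - u n z))\<^sup>2) \<partial>circle) \<le> ennreal e"
    if N: "\<forall>i\<ge>N. \<forall>j\<ge>N. sqnorm (\<lambda>z. u i z - u j z) < e" and n: "n \<ge> N" for n N e
  proof -
    have "(\<integral>\<^sup>+z. ennreal ((cmod (g z - u n z))\<^sup>2) \<partial>circle) =
        (\<integral>\<^sup>+z. liminf (\<lambda>i. ennreal ((cmod (u (r i) z - u n z))\<^sup>2)) \<partial>circle)"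
    proof (rule nn_integral_cong_AE)
      show "AE z in circle. ennreal ((cmod (g z - u n z))\<^sup>2) =
          liminf (\<lambda>i. ennreal ((cmod (u (r i) z - u n z))\<^sup>2))"
        using lim
      proof eventually_elim
        case (elim z)
        have "(\<lambda>i. ennreal ((cmod (u (r i) z - u n z))\<^sup>2)) \<longlonglongrightarrow> ennreal ((cmod (g z - u n z))\<^sup>2)"
          by (intro tendsto_intros elim)
        then show ?case
          by (intro lim_imp_Liminf[symmetric] trivial_limit_sequentially)
      qed
    qed
    also have "\<dots> \<le> liminf (\<lambda>i. \<integral>\<^sup>+z. ennreal ((cmod (u (r i) z - u n z))\<^sup>2) \<partial>circle)"
      by (rule nn_integral_liminf) measurable
    also have "\<dots> = liminf (\<lambda>i. ennreal (sqnorm (\<lambda>z. u (r i) z - u n z)))"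
      by (simp add: nn_integral_sq L2_diff u)
    also have "\<dots> \<le> liminf (\<lambda>i::nat. ennreal e)"
    proof (rule Liminf_mono)
      have "\<forall>\<^sub>F i in sequentially. N \<le> r i"
        using eventually_ge_at_top[of N] seq_suble[OF r(1)]
        by (elim eventually_mono) (meson order_trans)
      then show "\<forall>\<^sub>F i in sequentially. ennreal (sqnorm (\<lambda>z. u (r i) z - u n z)) \<le> ennreal e"
        by eventually_elim (rule ennreal_leI[OF less_imp_le], use N n in blast)
    qed
    also have "\<dots> = ennreal e"
      by (simp add: Liminf_const)
    finally show ?thesis .
  qed
  have diff: "(\<lambda>z. g z - u n z) \<in> L2"
    if "\<forall>i\<ge>N. \<forall>j\<ge>N. sqnorm (\<lambda>z. u i z - u j z) < e" "n \<ge> N" for n N e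
  proof (rule L2I)
    show "integrable circle (\<lambda>z. (cmod (g z - u n z))\<^sup>2)"
      using bound[OF that] by (intro integrableI_bounded) (auto intro: order_le_less_trans)
  qed measurable
  \<comment> \<open>A single index places \<open>g\<close> in \<open>L2\<close>: both
    \<open>g - u N\<close> and \<open>u N\<close> are square integrable.\<close>
  obtain N where "\<forall>i\<ge>N. \<forall>j\<ge>N. sqnorm (\<lambda>z. u i z - u j z) < 1"
    using Cauchy[of 1] by auto
  from diff[OF this order_refl] have "(\<lambda>z. (g z - u N z) + u N z) \<in> L2"
    by (rule L2_add[OF _ u])
  then have g: "g \<in> L2" by simp
  have "(\<lambda>n. sqnorm (\<lambda>z. g z - u n z)) \<longlonglongrightarrow> 0"
  proof (rule LIMSEQ_I)
    fix e :: real assume "0 < e"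
    \<comment> \<open>Halving turns the non-strict bound left by Fatou into a strict one.\<close>
    then obtain N where N: "\<forall>i\<ge>N. \<forall>j\<ge>N. sqnorm (\<lambda>z. u i z - u j z) < e / 2"
      using Cauchy[of "e / 2"] by auto
    have "sqnorm (\<lambda>z. g z - u n z) < e" if "n \<ge> N" for n
    proof -
      have "ennreal (sqnorm (\<lambda>z. g z - u n z)) \<le> ennreal (e / 2)"
        using bound[OF N that] by (simp add: nn_integral_sq L2_diff u g)
      then show ?thesis
        using \<open>0 < e\<close> by (simp add: ennreal_le_iff)
    qed
    then show "\<exists>N. \<forall>n\<ge>N. norm (sqnorm (\<lambda>z. g z - u n z) - 0) < e"
      by (auto simp: sqnorm_nonneg)
  qed
  with g show ?thesis by (rule that)
qed

section \<open>Uniqueness of Fourier coefficients\<close>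

lemma cnj_eq_inverse: "cmod z = 1 \<Longrightarrow> cnj z = inverse z"
  using complex_norm_square[of z] by (intro inverse_unique[symmetric]) simp

lemma fourier_coeff_eq: "fourier_coeff f n = (LINT z|circle. f z * z powi (- n))"
  if [measurable]: "f \<in> borel_measurable borel"
proof -
  have "AE z in circle. f z * cnj (z powi n) = f z * z powi (- n)"
    using AE_circle_cmod
  proof eventually_elim
    case (elim z)
    then have "cnj z = inverse z"
      by (rule cnj_eq_inverse)
    then show ?case
      by (simp add: power_int_minus power_int_inverse)
  qed
  then show ?thesis
    unfolding fourier_coeff_def L2_inner_def by (intro integral_cong_AE) auto
qed

lemma fourier_coeff_shift:
  assumes [measurable]: "f \<in> borel_measurable borel"
  shows "fourier_coeff (\<lambda>z. z powi m * f z) n = fourier_coeff f (n - m)"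
proof -
  have "AE z in circle. z powi m * f z * z powi (- n) = f z * z powi (- (n - m))"
    using AE_circle_cmod
  proof eventually_elim
    case (elim z)
    then have "z \<noteq> 0" by auto
    then have "z powi m * z powi (- n) = z powi (- (n - m))"
      by (simp flip: power_int_add)
    then show ?case by (simp add: mult_ac)
  qed
  then show ?thesis
    by (subst (1 2) fourier_coeff_eq) (auto intro!: integral_cong_AE)
qed

lemma fourier_coeff_cong_AE:
  assumes [measurable]: "f \<in> borel_measurable borel" "g \<in> borel_measurable borel"
    and "AE z in circle. f z = g z"
  shows "fourier_coeff f n = fourier_coeff g n"
  unfolding fourier_coeff_def by (rule L2_inner_cong_AE) (use assms(3) in auto)

lemma fourier_coeff_powi: "fourier_coeff (\<lambda>z. z powi m) n = (if n = m then 1 else 0)"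
  using fourier_coeff_shift[of "\<lambda>z. 1" m n]
  by (simp add: fourier_coeff_eq integral_circle_powi)

section \<open>Polynomial approximation and vanishing of set integrals\<close>

lemma real_polynomial_Linf:
  fixes p :: "complex \<Rightarrow> real"
  assumes "real_polynomial_function p"
  shows "(\<lambda>z. of_real (p z)) \<in> Linf"
proof -
  have cont: "continuous_on S p" for S
    using assms by (simp add: continuous_on_polymonial_function real_polynomial_function_eq)
  have [measurable]: "p \<in> borel_measurable borel"
    by (rule borel_measurable_continuous_onI[OF cont])
  obtain C where C: "\<And>z. z \<in> sphere 0 1 \<Longrightarrow> norm (p z) \<le> C"
    using compact_imp_bounded[OF compact_continuous_image[OF cont compact_sphere[of 0 1]]]
    unfolding bounded_iff by blast
  show ?thesis
    by (rule LinfI[of _ C]) (use AE_circle_cmod C in auto)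
qed

text \<open>Vanishing of all Fourier coefficients survives multiplication by a polynomial in the real
  and imaginary parts, because on the circle those are combinations of \<open>z\<close> and its inverse.\<close>

lemma fourier_coeff_real_polynomial_mult:
  fixes p :: "complex \<Rightarrow> real"
  assumes "real_polynomial_function p" "f \<in> L2" "\<And>n. fourier_coeff f n = 0"
  shows "fourier_coeff (\<lambda>z. of_real (p z) * f z) n = 0"
  using assms
proof (induction p arbitrary: f n rule: real_polynomial_function.induct)
  case (linear p)
  note [measurable] = linear(2)
  define \<alpha> \<beta> where "\<alpha> = p 1" and "\<beta> = p \<i>"
  \<comment> \<open>The real linear form \<open>p\<close> is twice the real part of
    \<open>a * z\<close>. This expresses it through \<open>z\<close> and \<open>cnj z\<close>, which
    on the circle shift Fourier coefficients by 1 and -1.\<close>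
  define a where "a = (of_real \<alpha> - \<i> * of_real \<beta>) / 2"
  have [measurable]: "p \<in> borel_measurable borel"
    using linear(1) by (intro borel_measurable_continuous_onI linear_continuous_on)
  have "p z = Re z * \<alpha> + Im z * \<beta>" for z
  proof -
    interpret bounded_linear p by fact
    have "z = Re z *\<^sub>R 1 + Im z *\<^sub>R \<i>"
      by (simp add: complex_eq_iff)
    then have "p z = p (Re z *\<^sub>R 1 + Im z *\<^sub>R \<i>)"
      by (rule arg_cong)
    also have "\<dots> = Re z * \<alpha> + Im z * \<beta>"
      by (simp only: add scaleR real_scaleR_def \<alpha>_def \<beta>_def)
    finally show ?thesis .
  qed
  then have p: "of_real (p z) = a * z + cnj a * cnj z" for z
    by (simp add: a_def complex_eq_iff field_simps)
  have eq: "AE z in circle. of_real (p z) * f z = a * (z powi 1 * f z) + cnj a * (z powi (-1) * f z)"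
    using AE_circle_cmod
  proof eventually_elim
    case (elim z)
    then have "cnj z = inverse z"
      by (rule cnj_eq_inverse)
    then show ?case by (simp add: p algebra_simps power_int_minus)
  qed
  have L2: "(\<lambda>z. z powi m * f z) \<in> L2" for m
    by (rule Linf_mult_L2[OF Linf_powi linear(2)])
  have "fourier_coeff (\<lambda>z. of_real (p z) * f z) n =
      fourier_coeff (\<lambda>z. a * (z powi 1 * f z) + cnj a * (z powi (-1) * f z)) n"
    by (rule fourier_coeff_cong_AE[OF _ _ eq]) measurable
  also have "\<dots> = a * fourier_coeff (\<lambda>z. z powi 1 * f z) n + cnj a * fourier_coeff (\<lambda>z. z powi (-1) * f z) n"
    unfolding fourier_coeff_def
    by (subst L2_inner_add_left[OF L2_cmult[OF L2] L2_cmult[OF L2] L2_powi])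
      (simp only: L2_inner_cmult_left)
  also have "\<dots> = 0"
    using linear(3) by (simp only: fourier_coeff_shift[OF L2_measurable[OF linear(2)]]) simp
  finally show ?case .
next
  case (const c)
  then show ?case
    by (simp add: fourier_coeff_def L2_inner_cmult_left)
next
  case (add p q)
  have "fourier_coeff (\<lambda>z. of_real (p z + q z) * f z) n =
      fourier_coeff (\<lambda>z. of_real (p z) * f z) n + fourier_coeff (\<lambda>z. of_real (q z) * f z) n"
    unfolding fourier_coeff_def of_real_add distrib_right
    by (intro L2_inner_add_left Linf_mult_L2 real_polynomial_Linf add L2_powi)
  then show ?case
    by (simp add: add)
next
  case (mult p q)
  have "fourier_coeff (\<lambda>z. of_real (p z) * (of_real (q z) * f z)) n = 0"
    by (intro mult Linf_mult_L2 real_polynomial_Linf)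
  then show ?case by (simp add: mult.assoc)
qed

text \<open>Stone-Weierstrass on the circle gives a polynomial in the real and imaginary parts
  within \<open>e\<close> of \<open>g\<close>. Its integral against \<open>f\<close> vanishes, so
  what remains is at most \<open>e\<close> times the integral of \<open>cmod (f z)\<close>.\<close>

lemma integral_mult_continuous_eq_0:
  fixes g :: "complex \<Rightarrow> real"
  assumes "f \<in> L2" "\<And>n. fourier_coeff f n = 0" and cont: "continuous_on UNIV g"
  shows "(LINT z|circle. of_real (g z) * f z) = 0"
proof -
  note [measurable] = L2_measurable[OF assms(1)]
  have [measurable]: "g \<in> borel_measurable borel"
    by (rule borel_measurable_continuous_onI[OF cont])
  define I where "I = (LINT z|circle. cmod (f z))"
  have I: "0 \<le> I" by (simp add: I_def)
  have le: "cmod (LINT z|circle. of_real (g z) * f z) \<le> e * I" if "e > 0" for e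
  proof -
    obtain p where p: "real_polynomial_function p" "\<And>z. z \<in> sphere 0 1 \<Longrightarrow> \<bar>g z - p z\<bar> < e"
      using Stone_Weierstrass_real_polynomial_function[OF compact_sphere continuous_on_subset[OF cont] \<open>e > 0\<close>]
      by blast
    note Linf = real_polynomial_Linf[OF p(1)]
    have "continuous_on UNIV p"
      using p(1) by (simp add: continuous_on_polymonial_function real_polynomial_function_eq)
    then have [measurable]: "p \<in> borel_measurable borel"
      by (rule borel_measurable_continuous_onI)
    have close: "AE z in circle. cmod (of_real (g z - p z) * f z) \<le> e * cmod (f z)"
      using AE_circle_cmod
    proof eventually_elim
      case (elim z)
      then have "\<bar>g z - p z\<bar> \<le> e"
        using p(2)[of z] by simp
      then show ?case
        unfolding norm_mult norm_of_real by (rule mult_right_mono) simp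
    qed
    have pf: "(\<lambda>z. of_real (p z) * f z) \<in> L2"
      by (rule Linf_mult_L2[OF Linf assms(1)])
    have L2: "(\<lambda>z. of_real (g z - p z) * f z) \<in> L2"
      by (rule L2_bounded_by[OF assms(1) _ close]) measurable
    have "(LINT z|circle. of_real (g z) * f z) =
        (LINT z|circle. of_real (g z - p z) * f z + of_real (p z) * f z)"
      by (simp add: algebra_simps)
    also have "\<dots> = (LINT z|circle. of_real (g z - p z) * f z) + (LINT z|circle. of_real (p z) * f z)"
      by (rule Bochner_Integration.integral_add[OF L2_integrable[OF L2] L2_integrable[OF pf]])
    also have "(LINT z|circle. of_real (p z) * f z) = 0"
      using fourier_coeff_real_polynomial_mult[OF p(1) assms(1,2), of 0]
      by (simp add: fourier_coeff_def L2_inner_def)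
    finally have "cmod (LINT z|circle. of_real (g z) * f z) \<le>
        (LINT z|circle. cmod (of_real (g z - p z) * f z))"
      by simp
    also have "\<dots> \<le> (LINT z|circle. e * cmod (f z))"
      by (rule integral_mono_AE[OF integrable_norm[OF L2_integrable[OF L2]] _ close])
        (use L2_integrable[OF assms(1)] in auto)
    finally show ?thesis by (simp add: I_def)
  qed
  have "cmod (LINT z|circle. of_real (g z) * f z) \<le> 0 + e" if "e > 0" for e
  proof -
    \<comment> \<open>Dividing by \<open>I + 1\<close> rather than \<open>I\<close> covers the case
      \<open>I = 0\<close>.\<close>
    have "cmod (LINT z|circle. of_real (g z) * f z) \<le> e / (I + 1) * I"
      using I that by (intro le) auto
    also have "\<dots> \<le> e"
      using I that by (simp add: field_simps)
    finally show ?thesis by simp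
  qed
  then have "cmod (LINT z|circle. of_real (g z) * f z) \<le> 0"
    by (rule field_le_epsilon)
  then show ?thesis by simp
qed

text \<open>The indicator of an open set is a pointwise limit of continuous cut-offs with values in
  [0, 1], built from the distance to the complement. Dominated convergence applies with majorant
  \<open>cmod (f z)\<close>.\<close>

lemma integral_open_eq_0:
  assumes "f \<in> L2" "\<And>n. fourier_coeff f n = 0" "open U"
  shows "(LINT z:U|circle. f z) = 0"
proof (cases "U = UNIV")
  case True
  then show ?thesis
    using assms(2)[of 0] by (simp add: fourier_coeff_def L2_inner_def set_lebesgue_integral_def)
next
  \<comment> \<open>Here the complement of \<open>U\<close> is nonempty. For an empty one
    \<open>infdist\<close> is 0 by convention and the cut-offs below would vanish
    identically.\<close>
  case False
  note [measurable] = L2_measurable[OF assms(1)]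
  have [measurable]: "U \<in> sets borel" using assms(3) by simp
  define g where "g = (\<lambda>(k::nat) z. min 1 (real k * infdist z (- U)))"
  have cont: "continuous_on UNIV (g k)" for k
    unfolding g_def by (intro continuous_intros)
  have [measurable]: "g k \<in> borel_measurable borel" for k
    by (rule borel_measurable_continuous_onI[OF cont])
  have lim: "(\<lambda>k. g k z) \<longlonglongrightarrow> indicator U z" for z
  proof (cases "z \<in> U")
    case True
    then have "infdist z (- U) > 0"
      using False assms(3) by (intro infdist_pos_not_in_closed) auto
    then obtain N where N: "1 < real N * infdist z (- U)"
      using reals_Archimedean3 by blast
    have "g k z = 1" if "k \<ge> N" for k
    proof -
      have "1 < real k * infdist z (- U)"
        using N mult_right_mono[of "real N" "real k" "infdist z (- U)"] that infdist_nonneg[of z "- U"]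
        by simp
      then show ?thesis by (simp add: g_def)
    qed
    then have "\<forall>\<^sub>F k in sequentially. g k z = 1"
      by (auto simp: eventually_sequentially)
    then show ?thesis
      using True by (simp add: tendsto_eventually)
  qed (simp add: g_def)
  have g01: "0 \<le> g k z" "g k z \<le> 1" for k z
    by (simp_all add: g_def infdist_nonneg)
  have "(\<lambda>k. LINT z|circle. of_real (g k z) * f z) \<longlonglongrightarrow> (LINT z|circle. of_real (indicator U z) * f z)"
  proof (rule integral_dominated_convergence)
    show "integrable circle (\<lambda>z. cmod (f z))"
      using L2_integrable[OF assms(1)] by simp
    show "AE z in circle. (\<lambda>k. of_real (g k z) * f z) \<longlonglongrightarrow> of_real (indicator U z) * f z"
      by (intro always_eventually allI tendsto_intros lim)
    show "AE z in circle. norm (of_real (g k z) * f z) \<le> cmod (f z)" for k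
      using g01 by (intro always_eventually allI) (simp add: norm_mult mult_left_le_one_le)
  qed measurable
  moreover have "(LINT z|circle. of_real (g k z) * f z) = 0" for k
    by (rule integral_mult_continuous_eq_0[OF assms(1,2) cont])
  ultimately have "(LINT z|circle. of_real (indicator U z) * f z) = 0"
    by (simp add: LIMSEQ_const_iff)
  then show ?thesis
    by (simp add: set_lebesgue_integral_def scaleR_conv_of_real)
qed

text \<open>Open sets are an intersection-stable generator of the Borel sets, so vanishing of the
  set integrals of \<open>f\<close> spreads from open sets to all Borel sets by Dynkin's
  argument.\<close>

lemma fourier_coeff_unique_0:
  assumes "f \<in> L2" "\<And>n. fourier_coeff f n = 0"
  shows "AE z in circle. f z = 0"
proof -
  note [measurable] = L2_measurable[OF assms(1)]
  have int: "set_integrable circle A f" if "A \<in> sets borel" for A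
    unfolding set_integrable_def
    by (rule integrable_mult_indicator[OF _ L2_integrable[OF assms(1)]]) (use that in simp)
  have UNIV: "(LINT z:UNIV|circle. f z) = 0"
    by (rule integral_open_eq_0[OF assms]) simp
  have zero: "(LINT z:A|circle. f z) = 0" if "A \<in> sets borel" for A
  proof -
    have "Int_stable {S :: complex set. open S}" "{S :: complex set. open S} \<subseteq> Pow UNIV"
      by (auto simp: Int_stable_def)
    moreover from that have "A \<in> sigma_sets UNIV {S. open S}"
      by (simp add: sets_borel)
    ultimately show ?thesis
    proof (induction A rule: sigma_sets_induct_disjoint)
      case (basic A)
      then show ?case by (intro integral_open_eq_0[OF assms]) simp
    next
      case empty
      then show ?case by (simp add: set_lebesgue_integral_def)
    next
      case (compl A)
      then have [measurable]: "A \<in> sets borel"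
        by (simp add: sets_borel)
      have "(LINT z:A \<union> (UNIV - A)|circle. f z) =
          (LINT z:A|circle. f z) + (LINT z:UNIV - A|circle. f z)"
        by (rule set_integral_Un) (auto intro!: int)
      with compl UNIV show ?case by simp
    next
      case (union A)
      then have A: "A i \<in> sets borel" for i
        by (auto simp: sets_borel)
      have "(LINT z:(\<Union>i. A i)|circle. f z) = (\<Sum>i. (LINT z:(A i)|circle. f z))"
        by (rule lebesgue_integral_countable_add)
          (use A union(1) in \<open>auto simp: disjoint_family_on_def intro!: int\<close>)
      with union show ?case by simp
    qed
  qed
  have Re: "(LINT z:A|circle. Re (f z)) = (LINT z:A|circle. 0)" if "A \<in> sets circle" for A
  proof -
    have "(LINT z:A|circle. Re (f z)) = Re (LINT z:A|circle. f z)"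
      unfolding set_lebesgue_integral_def
      using int[of A] that by (subst integral_Re[symmetric]) (auto simp: set_integrable_def)
    then show ?thesis using zero that by simp
  qed
  have Im: "(LINT z:A|circle. Im (f z)) = (LINT z:A|circle. 0)" if "A \<in> sets circle" for A
  proof -
    have "(LINT z:A|circle. Im (f z)) = Im (LINT z:A|circle. f z)"
      unfolding set_lebesgue_integral_def
      using int[of A] that by (subst integral_Im[symmetric]) (auto simp: set_integrable_def)
    then show ?thesis using zero that by simp
  qed
  \<comment> \<open>A real integrable function is determined a.e. by its set integrals; both parts
    are compared with 0.\<close>
  have "AE z in circle. Re (f z) = 0" "AE z in circle. Im (f z) = 0"
    using L2_integrable[OF assms(1)] by (auto intro!: density_unique_real Re Im)
  then show ?thesis
    by eventually_elim (simp add: complex_eq_iff)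
qed

section \<open>Hardy space and model spaces\<close>

lemma fourier_coeff_diff:
  "f \<in> L2 \<Longrightarrow> g \<in> L2 \<Longrightarrow> fourier_coeff (\<lambda>z. f z - g z) n = fourier_coeff f n - fourier_coeff g n"
  unfolding fourier_coeff_def by (intro L2_inner_diff_left L2_powi)

lemma fourier_coeff_cmult: "fourier_coeff (\<lambda>z. c * f z) n = c * fourier_coeff f n"
  unfolding fourier_coeff_def by (rule L2_inner_cmult_left)

lemma fourier_coeff_const: "fourier_coeff (\<lambda>z. c) n = (if n = 0 then c else 0)"
  using fourier_coeff_cmult[of c "\<lambda>z. z powi 0" n] fourier_coeff_powi[of 0 n] by simp

lemma fourier_coeff_cnj:
  assumes [measurable]: "f \<in> borel_measurable borel"
  shows "fourier_coeff (\<lambda>z. cnj (f z)) n = cnj (fourier_coeff f (- n))"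
proof -
  have "fourier_coeff (\<lambda>z. cnj (f z)) n = (LINT z|circle. cnj (f z * z powi n))"
    unfolding fourier_coeff_def L2_inner_def by simp
  also have "\<dots> = cnj (LINT z|circle. f z * z powi n)"
    by (rule Bochner_Integration.integral_cnj)
  also have "\<dots> = cnj (fourier_coeff f (- n))"
    by (simp add: fourier_coeff_eq)
  finally show ?thesis .
qed

section \<open>Finite Parseval identity, Bessel's inequality and the Riesz projection\<close>

lemma sqnorm_sum_powi:
  assumes "finite I"
  shows "sqnorm (\<lambda>z. \<Sum>n\<in>I. c n * z powi int n) = (\<Sum>n\<in>I. (cmod (c n))\<^sup>2)"
proof -
  let ?S = "\<lambda>z. \<Sum>n\<in>I. c n * z powi int n"
  have S: "?S \<in> L2"
    by (intro L2_sum L2_cmult L2_powi)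
  have coeff: "fourier_coeff ?S (int m) = c m" if "m \<in> I" for m
  proof -
    have "fourier_coeff ?S (int m) = (\<Sum>n\<in>I. fourier_coeff (\<lambda>z. c n * z powi int n) (int m))"
      unfolding fourier_coeff_def by (intro L2_inner_sum_left L2_cmult L2_powi)
    \<comment> \<open>\<open>power_int_of_nat\<close> is disabled because it would turn
      \<open>z powi int n\<close> into \<open>z ^ n\<close>, which \<open>fourier_coeff_powi\<close>
      does not match.\<close>
    also have "\<dots> = (\<Sum>n\<in>I. if n = m then c n else 0)"
      by (intro sum.cong) (auto simp: fourier_coeff_cmult fourier_coeff_powi simp del: power_int_of_nat)
    finally show ?thesis using that assms by simp
  qed
  have "of_real (sqnorm ?S) = L2_inner ?S ?S"
    by (rule L2_inner_self[OF S, symmetric])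
  also have "\<dots> = (\<Sum>n\<in>I. c n * cnj (fourier_coeff ?S (int n)))"
    by (subst L2_inner_sum_left[OF L2_cmult[OF L2_powi] S])
      (simp add: L2_inner_cmult_left fourier_coeff_def flip: L2_inner_commute)
  also have "\<dots> = of_real (\<Sum>n\<in>I. (cmod (c n))\<^sup>2)"
    unfolding of_real_sum by (intro sum.cong) (simp_all only: coeff complex_norm_square)
  finally show ?thesis
    by (simp only: of_real_eq_iff)
qed

text \<open>For the partial sum \<open>?S\<close> of \<open>f\<close> over \<open>I\<close>, both
  \<open>L2_inner ?S f\<close> and \<open>sqnorm ?S\<close> equal the left-hand side
  \<open>B\<close>. Cauchy-Schwarz then reads \<open>B * B \<le> B * sqnorm f\<close>, and a nonzero
  \<open>B\<close> cancels.\<close>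

lemma Bessel_inequality:
  assumes "f \<in> L2" "finite I"
  shows "(\<Sum>n\<in>I. (cmod (fourier_coeff f (int n)))\<^sup>2) \<le> sqnorm f"
proof -
  define B where "B = (\<Sum>n\<in>I. (cmod (fourier_coeff f (int n)))\<^sup>2)"
  let ?S = "\<lambda>z. \<Sum>n\<in>I. fourier_coeff f (int n) * z powi int n"
  have B: "0 \<le> B" by (simp add: B_def sum_nonneg)
  have "L2_inner ?S f = (\<Sum>n\<in>I. fourier_coeff f (int n) * cnj (fourier_coeff f (int n)))"
    by (subst L2_inner_sum_left[OF L2_cmult[OF L2_powi] assms(1)])
      (simp add: L2_inner_cmult_left fourier_coeff_def flip: L2_inner_commute)
  also have "\<dots> = of_real B"
    unfolding B_def of_real_sum by (simp only: complex_norm_square)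
  finally have SB: "L2_inner ?S f = of_real B" .
  have "?S \<in> L2"
    by (intro L2_sum L2_cmult L2_powi)
  from L2_Cauchy_Schwarz[OF this assms(1)] have "B * B \<le> B * sqnorm f"
    using sqnorm_sum_powi[OF assms(2), of "\<lambda>n. fourier_coeff f (int n)"]
    unfolding SB B_def[symmetric] by (simp add: power2_eq_square)
  then show ?thesis
    using B sqnorm_nonneg[of f] unfolding B_def[symmetric]
    by (cases "B = 0") (auto simp: mult_le_cancel_left)
qed

text \<open>Bessel makes the squared coefficients summable, so by the finite Parseval identity the
  partial sums over nonnegative frequencies are Cauchy, and completeness supplies the limit. Their
  convergence is kept in the conclusion because orthogonality is later checked on partial
  sums.\<close>

lemma riesz_projection_exists:
  assumes "f \<in> L2"
  obtains g where "g \<in> L2"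
    "(\<lambda>N. sqnorm (\<lambda>z. g z - (\<Sum>n<N. fourier_coeff f (int n) * z powi int n))) \<longlonglongrightarrow> 0"
    "\<And>n. fourier_coeff g n = (if n \<ge> 0 then fourier_coeff f n else 0)"
proof -
  define c where "c = (\<lambda>n. fourier_coeff f (int n))"
  define S where "S = (\<lambda>(N::nat) z. \<Sum>n<N. c n * z powi int n)"
  have S: "S N \<in> L2" for N
    unfolding S_def by (intro L2_sum L2_cmult L2_powi)
  have "(\<Sum>n<N. (cmod (c n))\<^sup>2) \<le> sqnorm f" for N
    unfolding c_def by (rule Bessel_inequality[OF assms]) simp
  then have summ: "summable (\<lambda>n. (cmod (c n))\<^sup>2)"
    by (intro summableI_nonneg_bounded[of _ "sqnorm f"]) auto
  have "\<exists>N. \<forall>i\<ge>N. \<forall>j\<ge>N. sqnorm (\<lambda>z. S i z - S j z) < e" if e: "e > 0" for e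
  proof -
    obtain N where N: "\<And>m n. m \<ge> N \<Longrightarrow> norm (\<Sum>k=m..<n. (cmod (c k))\<^sup>2) < e"
      using summ[unfolded summable_Cauchy, rule_format, OF e] by metis
    have less: "sqnorm (\<lambda>z. S i z - S j z) < e" if "j \<ge> N" "i \<ge> j" for i j
    proof -
      have "(\<lambda>z. S i z - S j z) = (\<lambda>z. \<Sum>n=j..<i. c n * z powi int n)"
        using that(2) by (auto simp: S_def sum_diff_nat_ivl lessThan_atLeast0)
      then have "sqnorm (\<lambda>z. S i z - S j z) = (\<Sum>n=j..<i. (cmod (c n))\<^sup>2)"
        by (simp only: sqnorm_sum_powi finite_atLeastLessThan)
      also have "\<dots> < e"
        using N[OF that(1), of i] by (simp add: sum_nonneg)
      finally show ?thesis .
    qed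
    have "sqnorm (\<lambda>z. S i z - S j z) < e" if "i \<ge> N" "j \<ge> N" for i j
      using less[of j i] less[of i j] that
      by (cases "i \<ge> j") (auto simp: sqnorm_def norm_minus_commute)
    then show ?thesis by blast
  qed
  then obtain g where g: "g \<in> L2" "(\<lambda>N. sqnorm (\<lambda>z. g z - S N z)) \<longlonglongrightarrow> 0"
    using L2_complete[of S, OF S] by metis
  have coeff: "fourier_coeff g m = (if m \<ge> 0 then fourier_coeff f m else 0)" for m
  proof (rule LIMSEQ_unique)
    show "(\<lambda>N. fourier_coeff (S N) m) \<longlonglongrightarrow> fourier_coeff g m"
      unfolding fourier_coeff_def by (rule L2_inner_tendsto[OF S g(1) L2_powi g(2)])
    \<comment> \<open>Once \<open>N\<close> exceeds \<open>m\<close>, the index \<open>m\<close>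
      occurs in the sum; for negative \<open>m\<close> no index ever matches.\<close>
    have "fourier_coeff (S N) m = (if m \<ge> 0 then fourier_coeff f m else 0)" if "N \<ge> nat (m + 1)" for N
    proof -
      have "fourier_coeff (S N) m = (\<Sum>n<N. fourier_coeff (\<lambda>z. c n * z powi int n) m)"
        unfolding S_def fourier_coeff_def by (intro L2_inner_sum_left L2_cmult L2_powi)
      also have "\<dots> = (\<Sum>n<N. if m = int n then c n else 0)"
        by (intro sum.cong) (auto simp: fourier_coeff_cmult fourier_coeff_powi simp del: power_int_of_nat)
      also have "\<dots> = (if m \<ge> 0 then fourier_coeff f m else 0)"
      proof (cases "m \<ge> 0")
        case True
        then have "(\<Sum>n<N. if m = int n then c n else 0) = (\<Sum>n<N. if n = nat m then c n else 0)"
          by (intro sum.cong) auto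
        then show ?thesis using True that by (simp add: c_def nat_less_iff)
      qed auto
      finally show ?thesis .
    qed
    then show "(\<lambda>N. fourier_coeff (S N) m) \<longlonglongrightarrow> (if m \<ge> 0 then fourier_coeff f m else 0)"
      by (intro tendsto_eventually eventually_sequentiallyI[of "nat (m + 1)"])
  qed
  show ?thesis
    using that[OF g(1) _ coeff] g(2) unfolding S_def c_def by blast
qed

section \<open>The Hardy space: closure, orthogonality and bounded analytic multipliers\<close>

lemma H2_imp_L2: "f \<in> H2 \<Longrightarrow> f \<in> L2"
  by (simp add: H2_def)

lemma H2_coeff: "f \<in> H2 \<Longrightarrow> n < 0 \<Longrightarrow> fourier_coeff f n = 0"
  by (simp add: H2_def)

lemma H2I: "f \<in> L2 \<Longrightarrow> (\<And>n. n < 0 \<Longrightarrow> fourier_coeff f n = 0) \<Longrightarrow> f \<in> H2"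
  by (simp add: H2_def)

lemma H2_diff: "f \<in> H2 \<Longrightarrow> g \<in> H2 \<Longrightarrow> (\<lambda>z. f z - g z) \<in> H2"
  by (auto intro!: H2I L2_diff simp: fourier_coeff_diff H2_imp_L2 H2_coeff)

lemma H2_cmult: "f \<in> H2 \<Longrightarrow> (\<lambda>z. c * f z) \<in> H2"
  by (auto intro!: H2I L2_cmult simp: fourier_coeff_cmult H2_imp_L2 H2_coeff)

lemma H2_powi: "n \<ge> 0 \<Longrightarrow> (\<lambda>z. z powi n) \<in> H2"
  by (auto intro!: H2I L2_powi simp: fourier_coeff_powi)

lemma H2_const: "(\<lambda>z. c) \<in> H2"
  by (rule H2I) (auto simp: fourier_coeff_const Linf_imp_L2 Linf_const)

text \<open>By uniqueness of Fourier coefficients \<open>f\<close> agrees a.e. with the limit of its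
  partial sums, and each power occurring in them is orthogonal to \<open>k\<close>.\<close>

lemma H2_orthogonal:
  assumes "f \<in> H2" "k \<in> L2" "\<And>n. n \<ge> 0 \<Longrightarrow> fourier_coeff k n = 0"
  shows "L2_inner f k = 0"
proof -
  note f = H2_imp_L2[OF assms(1)]
  let ?S = "\<lambda>N z. \<Sum>n<N. fourier_coeff f (int n) * z powi int n"
  obtain g where g: "g \<in> L2" "(\<lambda>N. sqnorm (\<lambda>z. g z - ?S N z)) \<longlonglongrightarrow> 0"
      "\<And>n. fourier_coeff g n = (if n \<ge> 0 then fourier_coeff f n else 0)"
    using riesz_projection_exists[OF f] by blast
  have "AE z in circle. f z - g z = 0"
    by (rule fourier_coeff_unique_0[OF L2_diff[OF f g(1)]])
      (simp add: fourier_coeff_diff f g(1) g(3) H2_coeff[OF assms(1)])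
  then have "L2_inner f k = L2_inner g k"
    by (intro L2_inner_cong_AE L2_measurable f g(1) assms(2)) auto
  moreover have "(\<lambda>N. L2_inner (?S N) k) \<longlonglongrightarrow> L2_inner g k"
    by (rule L2_inner_tendsto[OF _ g(1) assms(2) g(2)]) (intro L2_sum L2_cmult L2_powi)
  moreover have "L2_inner (?S N) k = 0" for N
  proof -
    have "L2_inner (\<lambda>z. z powi int n) k = 0" for n
      using assms(3)[of "int n"] L2_inner_commute[of "\<lambda>z. z powi int n" k]
      by (simp add: fourier_coeff_def)
    then show ?thesis
      by (subst L2_inner_sum_left[OF L2_cmult[OF L2_powi] assms(2)])
        (simp add: L2_inner_cmult_left)
  qed
  ultimately show ?thesis
    by (simp add: LIMSEQ_const_iff)
qed

lemma L2_inner_mult_left: "L2_inner (\<lambda>z. u z * f z) g = L2_inner f (\<lambda>z. cnj (u z) * g z)"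
  by (simp add: L2_inner_def mult_ac)

text \<open>Moving \<open>f\<close> to the other side of the inner product avoids multiplying
  Fourier series. For \<open>n < 0\<close> and \<open>m \<ge> 0\<close>, the \<open>m\<close>-th
  coefficient of \<open>cnj (f z) * z powi n\<close> is the conjugate of the coefficient of
  \<open>f\<close> at \<open>n - m < 0\<close>, so that function is orthogonal to
  \<open>g\<close>.\<close>

lemma Hinf_mult_H2:
  assumes "f \<in> Hinf" "g \<in> H2"
  shows "(\<lambda>z. f z * g z) \<in> H2"
proof (rule H2I)
  have f: "f \<in> Linf" "f \<in> H2" and g: "g \<in> L2"
    using assms by (auto simp: Hinf_def H2_imp_L2)
  note fm = Linf_measurable[OF f(1)]
  have [measurable]: "(\<lambda>z. cnj (f z)) \<in> borel_measurable borel"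
    using fm by measurable
  show "(\<lambda>z. f z * g z) \<in> L2"
    by (rule Linf_mult_L2[OF f(1) g])
  fix n :: int assume n: "n < 0"
  have "fourier_coeff (\<lambda>z. f z * g z) n = L2_inner g (\<lambda>z. cnj (f z) * z powi n)"
    unfolding fourier_coeff_def by (rule L2_inner_mult_left)
  also have "\<dots> = 0"
  proof (rule H2_orthogonal[OF assms(2)])
    show "(\<lambda>z. cnj (f z) * z powi n) \<in> L2"
      by (rule Linf_mult_L2[OF Linf_cnj[OF f(1)] L2_powi])
    fix m :: int assume "m \<ge> 0"
    then have "cnj (fourier_coeff f (n - m)) = 0"
      using H2_coeff[OF f(2)] n by simp
    then show "fourier_coeff (\<lambda>z. cnj (f z) * z powi n) m = 0"
      using fourier_coeff_shift[of "\<lambda>z. cnj (f z)" n m] fourier_coeff_cnj[OF fm, of "m - n"]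
      by (simp add: mult.commute)
  qed
  finally show "fourier_coeff (\<lambda>z. f z * g z) n = 0" .
qed

section \<open>Inner functions, model spaces and their orthogonal projections\<close>

lemma inner_functionD:
  assumes "inner_function \<theta>"
  shows "\<theta> \<in> Hinf" "\<theta> \<in> Linf" "\<theta> \<in> H2" "AE z in circle. cnj (\<theta> z) * \<theta> z = 1"
proof -
  show "AE z in circle. cnj (\<theta> z) * \<theta> z = 1"
  proof -
    have "AE z in circle. cmod (\<theta> z) = 1"
      using assms by (simp add: inner_function_def)
    then show ?thesis
    proof eventually_elim
      case (elim z)
      then show ?case
        using complex_norm_square[of "\<theta> z"] by (simp add: mult.commute)
    qed
  qed
qed (use assms in \<open>auto simp: inner_function_def Hinf_def\<close>)

lemma L2_inner_inner_function_cancel: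
  assumes "inner_function \<theta>" and [measurable]: "f \<in> borel_measurable borel" "g \<in> borel_measurable borel"
  shows "L2_inner f (\<lambda>z. \<theta> z * g z) = L2_inner (\<lambda>z. cnj (\<theta> z) * f z) g"
    and "L2_inner (\<lambda>z. \<theta> z * f z) (\<lambda>z. \<theta> z * g z) = L2_inner f g"
proof -
  note [measurable] = Linf_measurable[OF inner_functionD(2)[OF assms(1)]]
  show "L2_inner f (\<lambda>z. \<theta> z * g z) = L2_inner (\<lambda>z. cnj (\<theta> z) * f z) g"
    by (simp add: L2_inner_mult_left)
  show "L2_inner (\<lambda>z. \<theta> z * f z) (\<lambda>z. \<theta> z * g z) = L2_inner f g"
  proof (rule L2_inner_cong_AE)
    show "AE z in circle. \<theta> z * f z * cnj (\<theta> z * g z) = f z * cnj (g z)"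
      using inner_functionD(4)[OF assms(1)]
    proof eventually_elim
      case (elim z)
      have "\<theta> z * f z * cnj (\<theta> z * g z) = (cnj (\<theta> z) * \<theta> z) * (f z * cnj (g z))"
        by simp
      then show ?case by (simp only: elim mult_1_left)
    qed
  qed measurable
qed

lemma model_space_imp_H2: "k \<in> model_space \<theta> \<Longrightarrow> k \<in> H2"
  by (simp add: model_space_def)

lemma model_spaceD:
  assumes "\<theta> \<in> Linf" "k \<in> model_space \<theta>" "g \<in> H2"
  shows "L2_inner k (\<lambda>z. \<theta> z * g z) = 0"
proof -
  have "(\<lambda>z. \<theta> z * g z) \<in> mult_set \<theta> H2"
    using assms(3) L2_measurable[OF Linf_mult_L2[OF assms(1) H2_imp_L2[OF assms(3)]]]
    by (auto simp: mult_set_def borel_measurable_circle)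
  then show ?thesis
    using assms(2) by (simp add: model_space_def)
qed

text \<open>\<open>mult_set\<close> contains all a.e. representatives, but inner products do not
  distinguish them, so literal products are enough as test functions.\<close>

lemma model_spaceI:
  assumes "\<theta> \<in> Linf" "k \<in> H2" "\<And>g. g \<in> H2 \<Longrightarrow> L2_inner k (\<lambda>z. \<theta> z * g z) = 0"
  shows "k \<in> model_space \<theta>"
  unfolding model_space_def
proof safe
  fix h assume "h \<in> mult_set \<theta> H2"
  then obtain g where g: "g \<in> H2" "AE z in circle. h z = \<theta> z * g z"
      and h: "h \<in> borel_measurable borel"
    by (auto simp: mult_set_def borel_measurable_circle)
  have "L2_inner k h = L2_inner k (\<lambda>z. \<theta> z * g z)"
    by (rule L2_inner_cong_AE)
      (use g h in \<open>auto intro: L2_measurable Linf_mult_L2 assms(1) H2_imp_L2[OF g(1)] H2_imp_L2[OF assms(2)]\<close>)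
  with assms(3)[OF g(1)] show "L2_inner k h = 0" by simp
qed (fact assms)

text \<open>The projection is \<open>P\<^sub>+ f - \<theta> P\<^sub>+ (cnj \<theta> P\<^sub>+ f)\<close>, with \<open>P\<^sub>+\<close> the Riesz projection onto \<open>H2\<close>.\<close>

lemma model_space_projection_exists:
  assumes "inner_function \<theta>" "f \<in> L2"
  obtains g where "g \<in> model_space \<theta>" "\<And>k. k \<in> model_space \<theta> \<Longrightarrow> L2_inner (\<lambda>z. f z - g z) k = 0"
proof -
  note \<theta> = inner_functionD[OF assms(1)]
  have ortho: "L2_inner k h = 0"
    if "k \<in> L2" "h \<in> H2" "\<And>n. n \<ge> 0 \<Longrightarrow> fourier_coeff k n = 0" for k h
    using H2_orthogonal[OF that(2,1,3)] L2_inner_commute[of k h] by simp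
  obtain a where a: "a \<in> L2" "\<And>n. fourier_coeff a n = (if n \<ge> 0 then fourier_coeff f n else 0)"
    using riesz_projection_exists[OF assms(2)] by blast
  have \<theta>a: "(\<lambda>z. cnj (\<theta> z) * a z) \<in> L2"
    by (rule Linf_mult_L2[OF Linf_cnj[OF \<theta>(2)] a(1)])
  obtain b where b: "b \<in> L2"
      "\<And>n. fourier_coeff b n = (if n \<ge> 0 then fourier_coeff (\<lambda>z. cnj (\<theta> z) * a z) n else 0)"
    using riesz_projection_exists[OF \<theta>a] by blast
  have H2: "a \<in> H2" "b \<in> H2"
    by (rule H2I, simp_all add: a b)+
  have \<theta>b: "(\<lambda>z. \<theta> z * b z) \<in> H2"
    by (rule Hinf_mult_H2[OF \<theta>(1) H2(2)])
  let ?g = "\<lambda>z. a z - \<theta> z * b z"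
  have g: "?g \<in> H2"
    by (rule H2_diff[OF H2(1) \<theta>b])
  show ?thesis
  proof (rule that)
    show "?g \<in> model_space \<theta>"
    proof (rule model_spaceI[OF \<theta>(2) g])
      fix h assume h: "h \<in> H2"
      have \<theta>h: "(\<lambda>z. \<theta> z * h z) \<in> L2"
        by (rule Linf_mult_L2[OF \<theta>(2) H2_imp_L2[OF h]])
      have "L2_inner ?g (\<lambda>z. \<theta> z * h z) = L2_inner (\<lambda>z. cnj (\<theta> z) * a z) h - L2_inner b h"
        by (simp add: L2_inner_diff_left a(1) H2_imp_L2[OF \<theta>b] \<theta>h L2_measurable[OF a(1)] L2_measurable[OF b(1)]
            L2_measurable[OF H2_imp_L2[OF h]] L2_inner_inner_function_cancel[OF assms(1)])
      also have "\<dots> = L2_inner (\<lambda>z. cnj (\<theta> z) * a z - b z) h"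
        by (rule L2_inner_diff_left[OF \<theta>a b(1) H2_imp_L2[OF h], symmetric])
      also have "\<dots> = 0"
        by (rule ortho[OF L2_diff[OF \<theta>a b(1)] h]) (simp add: fourier_coeff_diff \<theta>a b)
      finally show "L2_inner ?g (\<lambda>z. \<theta> z * h z) = 0" .
    qed
    fix k assume k: "k \<in> model_space \<theta>"
    note kH2 = model_space_imp_H2[OF k]
    \<comment> \<open>The error splits into a part with only negative frequencies and a part in
      \<theta> \<open>H2\<close>; each is orthogonal to \<open>k\<close>.\<close>
    have "L2_inner (\<lambda>z. f z - ?g z) k = L2_inner (\<lambda>z. (f z - a z) + \<theta> z * b z) k"
      by (simp add: algebra_simps)
    also have "\<dots> = L2_inner (\<lambda>z. f z - a z) k + L2_inner (\<lambda>z. \<theta> z * b z) k"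
      by (rule L2_inner_add_left[OF L2_diff[OF assms(2) a(1)] H2_imp_L2[OF \<theta>b] H2_imp_L2[OF kH2]])
    also have "L2_inner (\<lambda>z. f z - a z) k = 0"
      by (rule ortho[OF L2_diff[OF assms(2) a(1)] kH2]) (simp add: fourier_coeff_diff assms(2) a)
    also have "L2_inner (\<lambda>z. \<theta> z * b z) k = 0"
      using model_spaceD[OF \<theta>(2) k H2(2)] L2_inner_commute[of "\<lambda>z. \<theta> z * b z" k] by simp
    finally show "L2_inner (\<lambda>z. f z - ?g z) k = 0" by simp
  qed
qed

text \<open>Existence of a projection ensures that the choice in \<open>orth_proj\<close> meets its
  specification. Then \<open>f\<close> and its projection \<open>p\<close> have the same inner
  products with the model space, and testing with \<open>p\<close> itself gives the direction from
  orthogonality to \<open>p = 0\<close>.\<close>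

lemma orth_proj_model_space_AE_0_iff:
  assumes "inner_function \<theta>" "f \<in> L2"
  shows "(AE z in circle. orth_proj (model_space \<theta>) f z = 0) \<longleftrightarrow> (\<forall>k\<in>model_space \<theta>. L2_inner f k = 0)"
proof -
  define p where "p = orth_proj (model_space \<theta>) f"
  have "\<exists>g. g \<in> model_space \<theta> \<and> (\<forall>k\<in>model_space \<theta>. L2_inner (\<lambda>z. f z - g z) k = 0)"
    using model_space_projection_exists[OF assms] by metis
  from someI_ex[OF this, folded orth_proj_def p_def] have p: "p \<in> model_space \<theta>" "\<And>k. k \<in> model_space \<theta> \<Longrightarrow> L2_inner (\<lambda>z. f z - p z) k = 0"
    by blast+
  note L2 = H2_imp_L2[OF model_space_imp_H2]
  have eq: "L2_inner f k = L2_inner p k" if "k \<in> model_space \<theta>" for k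
    using p(2)[OF that] L2_inner_diff_left[OF assms(2) L2[OF p(1)] L2[OF that]] by simp
  show ?thesis
    unfolding p_def[symmetric]
  proof
    assume "AE z in circle. p z = 0"
    then have "L2_inner p k = L2_inner (\<lambda>z. 0) k" if "k \<in> model_space \<theta>" for k
      by (intro L2_inner_cong_AE) (auto intro: L2_measurable L2 p(1) that)
    moreover have "L2_inner (\<lambda>z. 0) k = 0" for k
      by (simp add: L2_inner_def)
    ultimately show "\<forall>k\<in>model_space \<theta>. L2_inner f k = 0"
      by (simp add: eq)
  next
    assume "\<forall>k\<in>model_space \<theta>. L2_inner f k = 0"
    then have "sqnorm p = 0"
      using p(1) eq[OF p(1)] L2_inner_self[OF L2[OF p(1)]] by simp
    then show "AE z in circle. p z = 0"
      by (rule sqnorm_eq_0_imp[OF L2[OF p(1)]])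
  qed
qed

section \<open>Vanishing restricted operators\<close>

lemma flip_measurable:
  assumes [measurable]: "f \<in> borel_measurable borel"
  shows "flip f \<in> borel_measurable borel"
  unfolding flip_def by measurable

lemma flip_L2:
  assumes "f \<in> L2"
  shows "flip f \<in> L2"
proof (rule L2I)
  note [measurable] = L2_measurable[OF assms]
  show [measurable]: "flip f \<in> borel_measurable borel"
    by (rule flip_measurable) measurable
  have "integrable (distr circle borel cnj) (\<lambda>z. (cmod (f z))\<^sup>2)"
    unfolding distr_circle_cnj by (rule L2_integrable_sq[OF assms])
  then have "integrable circle (\<lambda>z. (cmod (f (cnj z)))\<^sup>2)"
    by (subst (asm) integrable_distr_eq) auto
  then show "integrable circle (\<lambda>z. (cmod (flip f z))\<^sup>2)"
    by (rule integrable_cong_AE_imp)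
      (use AE_circle_cmod in \<open>auto simp: flip_def norm_mult\<close>)
qed

text \<open>On the circle the flip sends \<open>z powi m\<close> to \<open>z powi (- m - 1)\<close>,
  the offset coming from the factor \<open>cnj z\<close>. It thus interchanges negative and
  nonnegative frequencies.\<close>

lemma fourier_coeff_flip:
  assumes [measurable]: "f \<in> borel_measurable borel"
  shows "fourier_coeff (flip f) n = fourier_coeff f (- n - 1)"
proof -
  have "fourier_coeff (flip f) n = (LINT z|circle. flip f z * z powi (- n))"
    by (rule fourier_coeff_eq[OF flip_measurable]) measurable
  also have "\<dots> = (LINT z|circle. (\<lambda>w. w * f w * cnj w powi (- n)) (cnj z))"
    by (simp add: flip_def)
  also have "\<dots> = (LINT z|circle. z * f z * cnj z powi (- n))"
    by (rule integral_circle_cnj) measurable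
  also have "\<dots> = (LINT z|circle. f z * z powi (- (- n - 1)))"
  proof (rule integral_cong_AE)
    show "AE z in circle. z * f z * cnj z powi (- n) = f z * z powi (- (- n - 1))"
      using AE_circle_cmod
    proof eventually_elim
      case (elim z)
      then have "z \<noteq> 0" by auto
      then have "z * z powi n = z powi (n + 1)"
        by (simp add: power_int_add_1')
      moreover have "cnj z powi (- n) = z powi n"
        using cnj_eq_inverse[OF elim] by (simp add: power_int_minus power_int_inverse)
      ultimately show ?case by (simp add: mult_ac add.commute)
    qed
  qed measurable
  also have "\<dots> = fourier_coeff f (- n - 1)"
    by (rule fourier_coeff_eq[symmetric]) measurable
  finally show ?thesis .
qed

lemma flip_mult_powi:
  "AE z in circle. flip (\<lambda>z. f z * z powi n) z = z powi (- n) * flip f z"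
  using AE_circle_cmod
  by eventually_elim (simp add: flip_def cnj_eq_inverse power_int_minus power_int_inverse)

text \<open>With \<open>t\<close> the mean of \<theta>, Pythagoras gives
  \<open>1 - (cmod t)\<^sup>2\<close> as the squared norm of \<theta> - \<open>t\<close>, and this
  is positive because \<theta> is not a.e. constant.\<close>

lemma fourier_coeff_0_inner_function_less_1:
  assumes "inner_function \<theta>" "\<not> ae_constant \<theta>"
  shows "cmod (fourier_coeff \<theta> 0) < 1"
proof -
  define t where "t = fourier_coeff \<theta> 0"
  note \<theta> = inner_functionD[OF assms(1)]
  note L2 = H2_imp_L2[OF \<theta>(3)] L2_powi[of 0, simplified] Linf_imp_L2[OF Linf_const]
  let ?d = "\<lambda>z. \<theta> z - t"
  have d: "?d \<in> L2"
    by (rule L2_diff) (fact L2)+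
  have \<theta>\<theta>: "L2_inner \<theta> \<theta> = 1"
    using L2_inner_inner_function_cancel(2)[OF assms(1), of "\<lambda>z. 1" "\<lambda>z. 1"]
    by (simp add: L2_inner_def)
  have \<theta>1: "L2_inner \<theta> (\<lambda>z. 1) = t"
    by (simp add: t_def fourier_coeff_def)
  have "of_real (sqnorm ?d) = L2_inner ?d ?d"
    by (rule L2_inner_self[OF d, symmetric])
  also have "\<dots> = L2_inner \<theta> ?d - L2_inner (\<lambda>z. t * 1) ?d"
    by (simp add: L2_inner_diff_left L2 d)
  also have "L2_inner \<theta> ?d = L2_inner \<theta> \<theta> - L2_inner \<theta> (\<lambda>z. t * 1)"
    by (simp add: L2_inner_diff_right L2)
  also have "L2_inner \<theta> (\<lambda>z. t * 1) = cnj t * t"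
    by (simp only: L2_inner_cmult_right \<theta>1)
  \<comment> \<open>\<open>t\<close> is the projection of \<theta> onto the constants, so
    \<open>?d\<close> is orthogonal to them.\<close>
  also have "L2_inner (\<lambda>z. t * 1) ?d = t * (L2_inner (\<lambda>z. 1) \<theta> - L2_inner (\<lambda>z. 1) (\<lambda>z. t * 1))"
    unfolding L2_inner_cmult_left by (simp add: L2_inner_diff_right L2)
  also have "\<dots> = 0"
    using L2_inner_commute[of "\<lambda>z. 1" \<theta>] unfolding \<theta>1 L2_inner_cmult_right
    by (simp add: L2_inner_def)
  finally have "of_real (sqnorm ?d) = 1 - cnj t * t"
    by (simp add: \<theta>\<theta>)
  also have "\<dots> = of_real (1 - (cmod t)\<^sup>2)"
    using complex_norm_square[of t] by (simp add: mult.commute)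
  finally have sq: "sqnorm ?d = 1 - (cmod t)\<^sup>2"
    by (simp only: of_real_eq_iff)
  have "sqnorm ?d \<noteq> 0"
  proof
    assume "sqnorm ?d = 0"
    then have "AE z in circle. \<theta> z - t = 0"
      by (rule sqnorm_eq_0_imp[OF d])
    then have "ae_constant \<theta>"
      by (auto simp: ae_constant_def)
    with assms(2) show False by simp
  qed
  then have "(cmod t)\<^sup>2 < 1"
    using sq sqnorm_nonneg[of ?d] by linarith
  then show ?thesis
    by (simp add: t_def power2_less_1_iff abs_square_less_1)
qed

text \<open>The function \<open>cnj (f z) - cnj t\<close> has no coefficients at
  \<open>n \<ge> 0\<close> and is therefore orthogonal to \<open>g\<close>, so only the mean of
  \<open>f\<close> contributes. For the holomorphic extensions this says that evaluation at the
  origin is multiplicative.\<close>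

lemma fourier_coeff_0_mult:
  assumes "f \<in> Hinf" "g \<in> H2"
  shows "fourier_coeff (\<lambda>z. f z * g z) 0 = fourier_coeff f 0 * fourier_coeff g 0"
proof -
  define t where "t = fourier_coeff f 0"
  have f: "f \<in> Linf" "f \<in> H2" and g: "g \<in> L2"
    using assms by (auto simp: Hinf_def H2_imp_L2)
  have cf: "(\<lambda>z. cnj (f z)) \<in> L2"
    by (rule Linf_imp_L2[OF Linf_cnj[OF f(1)]])
  have ct: "(\<lambda>z. cnj t) \<in> L2"
    by (rule Linf_imp_L2[OF Linf_const])
  have "fourier_coeff (\<lambda>z. f z * g z) 0 = L2_inner g (\<lambda>z. cnj (f z))"
    unfolding fourier_coeff_def L2_inner_mult_left by simp
  also have "\<dots> = L2_inner g (\<lambda>z. cnj (f z) - cnj t) + L2_inner g (\<lambda>z. cnj t * 1)"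
    by (simp add: L2_inner_diff_right cf ct g)
  also have "L2_inner g (\<lambda>z. cnj (f z) - cnj t) = 0"
  proof (rule H2_orthogonal[OF assms(2) L2_diff[OF cf ct]])
    fix n :: int assume "n \<ge> 0"
    then show "fourier_coeff (\<lambda>z. cnj (f z) - cnj t) n = 0"
      unfolding fourier_coeff_diff[OF cf ct] fourier_coeff_cnj[OF Linf_measurable[OF f(1)]]
        fourier_coeff_const
      by (cases "n = 0") (simp_all add: t_def H2_coeff[OF f(2)])
  qed
  also have "L2_inner g (\<lambda>z. cnj t * 1) = t * fourier_coeff g 0"
    unfolding L2_inner_cmult_right by (simp add: fourier_coeff_def)
  finally show ?thesis by (simp add: t_def)
qed

text \<open>The reproducing kernel of the model space at the origin.\<close>

lemma model_space_kernel:
  assumes "inner_function \<theta>"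
  shows "(\<lambda>z. 1 - cnj (fourier_coeff \<theta> 0) * \<theta> z) \<in> model_space \<theta>"
proof (rule model_spaceI)
  define t where "t = fourier_coeff \<theta> 0"
  note \<theta> = inner_functionD[OF assms]
  show "\<theta> \<in> Linf" by fact
  show "(\<lambda>z. 1 - cnj (fourier_coeff \<theta> 0) * \<theta> z) \<in> H2"
    by (intro H2_diff H2_const H2_cmult \<theta>)
  fix g assume g: "g \<in> H2"
  have \<theta>g: "(\<lambda>z. \<theta> z * g z) \<in> L2"
    by (rule Linf_mult_L2[OF \<theta>(2) H2_imp_L2[OF g]])
  have "L2_inner (\<lambda>z. 1 - cnj t * \<theta> z) (\<lambda>z. \<theta> z * g z) =
      L2_inner (\<lambda>z. 1) (\<lambda>z. \<theta> z * g z) - cnj t * L2_inner \<theta> (\<lambda>z. \<theta> z * g z)"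
    by (simp only: L2_inner_diff_left[OF L2_one L2_cmult[OF H2_imp_L2[OF \<theta>(3)]] \<theta>g] L2_inner_cmult_left)
  also have "L2_inner (\<lambda>z. 1) (\<lambda>z. \<theta> z * g z) = cnj (fourier_coeff (\<lambda>z. \<theta> z * g z) 0)"
    using L2_inner_commute[of "\<lambda>z. 1" "\<lambda>z. \<theta> z * g z"] by (simp add: fourier_coeff_def)
  also have "L2_inner \<theta> (\<lambda>z. \<theta> z * g z) = L2_inner (\<lambda>z. 1) g"
    using L2_inner_inner_function_cancel(2)[OF assms, of "\<lambda>z. 1" g] L2_measurable[OF H2_imp_L2[OF g]]
    by simp
  also have "L2_inner (\<lambda>z. 1) g = cnj (fourier_coeff g 0)"
    using L2_inner_commute[of "\<lambda>z. 1" g] by (simp add: fourier_coeff_def)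
  finally show "L2_inner (\<lambda>z. 1 - cnj (fourier_coeff \<theta> 0) * \<theta> z) (\<lambda>z. \<theta> z * g z) = 0"
    by (simp add: fourier_coeff_0_mult[OF \<theta>(1) g] t_def)
qed

text \<open>This is the backward shift of \<theta>, the conjugate counterpart of the kernel at the
  origin. Its pairing with \<theta> \<open>g\<close> reduces to pairings of
  \<open>z powi (- 1)\<close> with \<open>g\<close> and with \<theta> \<open>g\<close>, both in
  \<open>H2\<close>, hence to 0.\<close>

lemma model_space_conj_kernel:
  assumes "inner_function \<theta>"
  shows "(\<lambda>z. z powi (- 1) * (\<theta> z - fourier_coeff \<theta> 0)) \<in> model_space \<theta>"
proof (rule model_spaceI)
  define t where "t = fourier_coeff \<theta> 0"
  note \<theta> = inner_functionD[OF assms]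
  note \<theta>m = Linf_measurable[OF \<theta>(2)] H2_imp_L2[OF \<theta>(3)]
  show "\<theta> \<in> Linf" by fact
  have d: "(\<lambda>z. \<theta> z - t) \<in> L2"
    by (rule L2_diff[OF \<theta>m(2) Linf_imp_L2[OF Linf_const]])
  show "(\<lambda>z. z powi (- 1) * (\<theta> z - fourier_coeff \<theta> 0)) \<in> H2"
    unfolding t_def[symmetric]
  proof (rule H2I)
    show "(\<lambda>z. z powi (- 1) * (\<theta> z - t)) \<in> L2"
      by (rule Linf_mult_L2[OF Linf_powi d])
    \<comment> \<open>The shift moves the coefficient at 0 to -1, and subtracting \<open>t\<close>
      has removed exactly that one.\<close>
    fix n :: int assume "n < 0"
    then show "fourier_coeff (\<lambda>z. z powi (- 1) * (\<theta> z - t)) n = 0"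
      using H2_coeff[OF \<theta>(3), of "n + 1"]
      unfolding fourier_coeff_shift[OF L2_measurable[OF d]]
      by (cases "n = - 1") (simp_all add: fourier_coeff_diff \<theta>m(2) Linf_imp_L2[OF Linf_const]
        fourier_coeff_const t_def)
  qed
  fix g assume g: "g \<in> H2"
  have \<theta>g: "(\<lambda>z. \<theta> z * g z) \<in> H2"
    by (rule Hinf_mult_H2[OF \<theta>(1) g])
  note gL2 = H2_imp_L2[OF g] and \<theta>gL2 = H2_imp_L2[OF \<theta>g]
  have 0: "L2_inner (\<lambda>z. z powi (- 1)) h = 0" if "h \<in> H2" for h
    using L2_inner_commute[of "\<lambda>z. z powi (- 1)" h] H2_coeff[OF that, of "- 1"]
    by (simp only: fourier_coeff_def) simp
  have "L2_inner (\<lambda>z. z powi (- 1) * (\<theta> z - t)) (\<lambda>z. \<theta> z * g z) =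
      L2_inner (\<lambda>z. \<theta> z * z powi (- 1) - t * z powi (- 1)) (\<lambda>z. \<theta> z * g z)"
    by (simp add: algebra_simps)
  also have "\<dots> = L2_inner (\<lambda>z. \<theta> z * z powi (- 1)) (\<lambda>z. \<theta> z * g z) -
      t * L2_inner (\<lambda>z. z powi (- 1)) (\<lambda>z. \<theta> z * g z)"
    by (simp only: L2_inner_diff_left[OF Linf_mult_L2[OF \<theta>(2) L2_powi] L2_cmult[OF L2_powi] \<theta>gL2]
        L2_inner_cmult_left)
  also have "L2_inner (\<lambda>z. \<theta> z * z powi (- 1)) (\<lambda>z. \<theta> z * g z) = L2_inner (\<lambda>z. z powi (- 1)) g"
    by (rule L2_inner_inner_function_cancel(2)[OF assms L2_measurable[OF L2_powi] L2_measurable[OF gL2]])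
  finally show "L2_inner (\<lambda>z. z powi (- 1) * (\<theta> z - fourier_coeff \<theta> 0)) (\<lambda>z. \<theta> z * g z) = 0"
    by (simp only: t_def 0[OF g] 0[OF \<theta>g]) simp
qed

section \<open>Vanishing of the operators as orthogonality, symbol classes as membership in
  \<open>H2\<close>\<close>

lemma mult_set_L2:
  assumes "\<eta> \<in> Linf" "h \<in> mult_set \<eta> H2"
  shows "h \<in> L2"
proof -
  obtain g where g: "g \<in> H2" "AE z in circle. h z = \<eta> z * g z" "h \<in> borel_measurable borel"
    using assms(2) by (auto simp: mult_set_def borel_measurable_circle)
  show ?thesis
    by (rule L2_cong_AE[OF Linf_mult_L2[OF assms(1) H2_imp_L2[OF g(1)]] g(3,2)])
qed

lemma mult_in_mult_set: "\<eta> \<in> Linf \<Longrightarrow> g \<in> H2 \<Longrightarrow> (\<lambda>z. \<eta> z * g z) \<in> mult_set \<eta> H2"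
  using L2_measurable[OF Linf_mult_L2[of \<eta> g]]
  by (auto simp: mult_set_def borel_measurable_circle H2_imp_L2)

text \<open>Here the chosen representative of the projection disappears, leaving orthogonality
  relations alone.\<close>

lemma zero_restricted_toeplitz_iff:
  assumes "\<phi> \<in> Linf" "\<eta> \<in> Linf" "inner_function \<theta>"
  shows "zero_operator_on (mult_set \<eta> H2) (restricted_toeplitz \<eta> \<theta> \<phi>) \<longleftrightarrow>
    (\<forall>h\<in>mult_set \<eta> H2. \<forall>k\<in>model_space \<theta>. L2_inner (\<lambda>z. \<phi> z * h z) k = 0)"
proof -
  have "(AE z in circle. restricted_toeplitz \<eta> \<theta> \<phi> h z = 0) \<longleftrightarrow>
      (\<forall>k\<in>model_space \<theta>. L2_inner (\<lambda>z. \<phi> z * h z) k = 0)" if "h \<in> mult_set \<eta> H2" for h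
    using orth_proj_model_space_AE_0_iff[OF assms(3) Linf_mult_L2[OF assms(1) mult_set_L2[OF assms(2) that]]] that
    by (simp add: restricted_toeplitz_def)
  then show ?thesis by (simp add: zero_operator_on_def)
qed

lemma zero_restricted_hankel_iff:
  assumes "\<phi> \<in> Linf" "\<eta> \<in> Linf" "inner_function \<theta>"
  shows "zero_operator_on (mult_set \<eta> H2) (restricted_hankel \<eta> \<theta> \<phi>) \<longleftrightarrow>
    (\<forall>h\<in>mult_set \<eta> H2. \<forall>k\<in>model_space \<theta>. L2_inner (flip (\<lambda>z. \<phi> z * h z)) k = 0)"
proof -
  have "(AE z in circle. restricted_hankel \<eta> \<theta> \<phi> h z = 0) \<longleftrightarrow>
      (\<forall>k\<in>model_space \<theta>. L2_inner (flip (\<lambda>z. \<phi> z * h z)) k = 0)" if "h \<in> mult_set \<eta> H2" for h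
    using orth_proj_model_space_AE_0_iff[OF assms(3) flip_L2[OF Linf_mult_L2[OF assms(1) mult_set_L2[OF assms(2) that]]]] that
    by (simp add: restricted_hankel_def)
  then show ?thesis by (simp add: zero_operator_on_def)
qed

text \<open>Multiplication by \<open>u\<close> is undone by \<open>cnj u\<close>, and the quotient
  is bounded because \<phi> and \<open>u\<close> are. The multiplier is merely unimodular since it
  will be \<open>cnj \<eta> * \<theta>\<close> or \<open>cnj \<eta>\<close>.\<close>

lemma mult_set_Hinf_iff:
  assumes "\<phi> \<in> Linf" "u \<in> Linf" "AE z in circle. cnj (u z) * u z = 1"
  shows "\<phi> \<in> mult_set u Hinf \<longleftrightarrow> (\<lambda>z. cnj (u z) * \<phi> z) \<in> H2"
proof -
  have Linf: "(\<lambda>z. cnj (u z) * \<phi> z) \<in> Linf"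
    by (rule Linf_mult[OF Linf_cnj[OF assms(2)] assms(1)])
  note m = Linf_measurable[OF assms(1)]
  show ?thesis
  proof
    assume "\<phi> \<in> mult_set u Hinf"
    then obtain g where g: "g \<in> Hinf" "AE z in circle. \<phi> z = u z * g z"
      by (auto simp: mult_set_def)
    have eq: "AE z in circle. cnj (u z) * \<phi> z = g z"
      using g(2) assms(3) by eventually_elim (simp flip: mult.assoc)
    have "fourier_coeff (\<lambda>z. cnj (u z) * \<phi> z) n = fourier_coeff g n" for n
      using g(1) by (intro fourier_coeff_cong_AE[OF _ _ eq])
        (auto simp: Hinf_def intro: Linf_measurable Linf)
    then show "(\<lambda>z. cnj (u z) * \<phi> z) \<in> H2"
      using g(1) by (intro H2I Linf_imp_L2[OF Linf]) (simp add: Hinf_def H2_coeff)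
  next
    assume H2: "(\<lambda>z. cnj (u z) * \<phi> z) \<in> H2"
    have "AE z in circle. \<phi> z = u z * (cnj (u z) * \<phi> z)"
      using assms(3)
    proof eventually_elim
      case (elim z)
      have "u z * (cnj (u z) * \<phi> z) = (cnj (u z) * u z) * \<phi> z"
        by (simp only: mult_ac)
      then show ?case by (simp only: elim mult_1_left)
    qed
    then show "\<phi> \<in> mult_set u Hinf"
      unfolding mult_set_def Hinf_def borel_measurable_circle
      using m Linf H2 by (intro CollectI conjI bexI[of _ "\<lambda>z. cnj (u z) * \<phi> z"]) auto
  qed
qed

section \<open>From orthogonality to analyticity of the symbol\<close>

lemma toeplitz_vanishing_imp_H2:
  assumes "inner_function \<theta>" "\<not> ae_constant \<theta>" "f \<in> Linf"
    and ortho: "\<And>n k. n \<ge> 0 \<Longrightarrow> k \<in> model_space \<theta> \<Longrightarrow> L2_inner (\<lambda>z. f z * z powi n) k = 0"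
  shows "(\<lambda>z. cnj (\<theta> z) * f z) \<in> H2"
proof (rule H2I)
  define t where "t = fourier_coeff \<theta> 0"
  note \<theta> = inner_functionD[OF assms(1)]
  note \<theta>m [measurable] = Linf_measurable[OF \<theta>(2)] and fm [measurable] = Linf_measurable[OF assms(3)]
  have u: "(\<lambda>z. cnj (\<theta> z) * f z) \<in> Linf"
    by (rule Linf_mult[OF Linf_cnj[OF \<theta>(2)] assms(3)])
  then show "(\<lambda>z. cnj (\<theta> z) * f z) \<in> L2"
    by (rule Linf_imp_L2)
  have fz: "(\<lambda>z. f z * z powi n) \<in> L2" for n
    by (rule Linf_mult_L2[OF assms(3) L2_powi])
  have inner_1: "L2_inner (\<lambda>z. f z * z powi n) (\<lambda>z. 1) = fourier_coeff f (- n)" for n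
    by (simp add: fourier_coeff_eq L2_inner_def)
  have inner_\<theta>: "L2_inner (\<lambda>z. f z * z powi n) \<theta> = fourier_coeff (\<lambda>z. cnj (\<theta> z) * f z) (- n)" for n
    by (simp add: fourier_coeff_eq L2_inner_def mult_ac)
  fix n :: int assume n: "n < 0"
  have U: "fourier_coeff f n = t * fourier_coeff (\<lambda>z. cnj (\<theta> z) * f z) n"
  proof -
    have "0 = L2_inner (\<lambda>z. f z * z powi (- n)) (\<lambda>z. 1 - cnj t * \<theta> z)"
      using ortho[OF _ model_space_kernel[OF assms(1)], of "- n"] n by (simp add: t_def)
    also have "\<dots> = fourier_coeff f n - t * fourier_coeff (\<lambda>z. cnj (\<theta> z) * f z) n"
      unfolding L2_inner_diff_right[OF L2_one L2_cmult[OF H2_imp_L2[OF \<theta>(3)]] fz]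
        L2_inner_cmult_right inner_1 inner_\<theta> by simp
    finally show ?thesis by simp
  qed
  have F: "fourier_coeff (\<lambda>z. cnj (\<theta> z) * f z) n = cnj t * fourier_coeff f n"
  proof -
    \<comment> \<open>The exponent \<open>- n - 1\<close> is still nonnegative for
      \<open>n < 0\<close>; the conjugated factor \<open>z powi (- 1)\<close> of the test function
      supplies the missing power of \<open>z\<close>.\<close>
    have "0 = L2_inner (\<lambda>z. f z * z powi (- n - 1)) (\<lambda>z. z powi (- 1) * (\<theta> z - t))"
      using ortho[OF _ model_space_conj_kernel[OF assms(1)], of "- n - 1"] n by (simp add: t_def)
    also have "\<dots> = L2_inner (\<lambda>z. f z * z powi (- n)) (\<lambda>z. \<theta> z - t)"
    proof (rule L2_inner_cong_AE)
      show "AE z in circle. f z * z powi (- n - 1) * cnj (z powi (- 1) * (\<theta> z - t)) =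
          f z * z powi (- n) * cnj (\<theta> z - t)"
        using AE_circle_cmod
      proof eventually_elim
        case (elim z)
        then have "z \<noteq> 0" by auto
        then have "z powi (- n - 1) * z = z powi (- n)"
          using power_int_add_1[of z "- n - 1"] by simp
        moreover have "cnj (z powi (- 1)) = z"
          using cnj_eq_inverse[OF elim] by (simp add: power_int_minus)
        ultimately show ?case
          unfolding complex_cnj_mult by (metis mult.assoc)
      qed
    qed measurable
    also have "\<dots> = L2_inner (\<lambda>z. f z * z powi (- n)) \<theta> - L2_inner (\<lambda>z. f z * z powi (- n)) (\<lambda>z. t * 1)"
      unfolding mult_1_right
      by (rule L2_inner_diff_right[OF H2_imp_L2[OF \<theta>(3)] Linf_imp_L2[OF Linf_const] fz])
    also have "\<dots> = fourier_coeff (\<lambda>z. cnj (\<theta> z) * f z) n - cnj t * fourier_coeff f n"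
      unfolding L2_inner_cmult_right inner_1 inner_\<theta> by simp
    finally show ?thesis by simp
  qed
  \<comment> \<open>\<open>U\<close> and \<open>F\<close> form a homogeneous linear system in two
    coefficients with determinant \<open>1 - cnj t * t\<close>, which is nonzero by this
    bound.\<close>
  have "cmod t < 1"
    unfolding t_def by (rule fourier_coeff_0_inner_function_less_1[OF assms(1,2)])
  then have "cmod (cnj t * t) < 1"
    using mult_strict_mono'[of "cmod t" 1 "cmod t" 1] by (simp add: norm_mult)
  then have "cnj t * t \<noteq> 1" by auto
  moreover have "(1 - cnj t * t) * fourier_coeff (\<lambda>z. cnj (\<theta> z) * f z) n = 0"
    using F unfolding U by (simp add: algebra_simps)
  ultimately show "fourier_coeff (\<lambda>z. cnj (\<theta> z) * f z) n = 0"
    by simp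
qed

text \<open>With \<open>G = flip f\<close>, orthogonality to the kernel at the origin gives
  \<open>\<langle>G, \<theta>\<^sup>j z\<^sup>m\<rangle> = \<theta>(0) \<langle>G, \<theta>\<^sup>j\<^sup>+\<^sup>1 z\<^sup>m\<rangle>\<close>; iterating, \<open>\<langle>G, z\<^sup>m\<rangle>\<close> is \<open>\<theta>(0)\<^sup>j\<close> times a quantity bounded in \<open>j\<close>.\<close>

lemma hankel_vanishing_imp_H2:
  assumes "inner_function \<theta>" "\<not> ae_constant \<theta>" "f \<in> Linf"
    and ortho: "\<And>n k. n \<ge> 0 \<Longrightarrow> k \<in> model_space \<theta> \<Longrightarrow> L2_inner (flip (\<lambda>z. f z * z powi n)) k = 0"
  shows "f \<in> H2"
proof (rule H2I)
  define t where "t = fourier_coeff \<theta> 0"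
  define G where "G = flip f"
  note \<theta> = inner_functionD[OF assms(1)]
  note \<theta>m [measurable] = Linf_measurable[OF \<theta>(2)] and fm [measurable] = Linf_measurable[OF assms(3)]
  show fL2: "f \<in> L2"
    by (rule Linf_imp_L2[OF assms(3)])
  have G: "G \<in> L2"
    unfolding G_def by (rule flip_L2[OF fL2])
  have [measurable]: "G \<in> borel_measurable borel"
    by (rule L2_measurable[OF G])
  have \<theta>G: "(\<lambda>z. cnj (\<theta> z) * G z) \<in> L2"
    by (rule Linf_mult_L2[OF Linf_cnj[OF \<theta>(2)] G])
  \<comment> \<open>\<open>?W\<close> is \<open>G\<close> times the conjugate of the kernel at the
    origin, so its coefficients at \<open>n \<ge> 0\<close> are exactly the inner products assumed
    to vanish.\<close>
  let ?W = "\<lambda>z. G z - t * (cnj (\<theta> z) * G z)"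
  have W: "?W \<in> L2"
    by (rule L2_diff[OF G L2_cmult[OF \<theta>G]])
  have W0: "fourier_coeff ?W n = 0" if "n \<ge> 0" for n
  proof -
    have "fourier_coeff ?W n = L2_inner (flip (\<lambda>z. f z * z powi n)) (\<lambda>z. 1 - cnj t * \<theta> z)"
      unfolding fourier_coeff_def
    proof (rule L2_inner_cong_AE)
      show "AE z in circle. ?W z * cnj (z powi n) =
          flip (\<lambda>z. f z * z powi n) z * cnj (1 - cnj t * \<theta> z)"
        using flip_mult_powi[of f n] AE_circle_cmod
      proof eventually_elim
        case (elim z)
        have "cnj (z powi n) = z powi (- n)"
          using cnj_eq_inverse[OF elim(2)] by (simp add: power_int_minus power_int_inverse)
        then show ?case
          unfolding elim(1) G_def by (simp add: algebra_simps)
      qed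
    qed (auto intro: flip_measurable)
    also have "\<dots> = 0"
      unfolding t_def by (rule ortho[OF that model_space_kernel[OF assms(1)]])
    finally show ?thesis .
  qed
  have pow: "(\<lambda>z. \<theta> z ^ j * z powi m) \<in> H2" if "m \<ge> 0" for j m
  proof (induction j)
    case (Suc j)
    then show ?case
      using Hinf_mult_H2[OF \<theta>(1) Suc] by (simp add: mult.assoc)
  qed (use H2_powi[OF that] in simp)
  define A where "A = (\<lambda>m j. L2_inner G (\<lambda>z. \<theta> z ^ j * z powi m))"
  \<comment> \<open>With only negative frequencies, \<open>?W\<close> is orthogonal to all of
    \<open>H2\<close>. In the second term \<open>cnj \<theta>\<close> passes to the other side and
    raises the power of \<theta> by one.\<close>
  have step: "A m j = t * A m (Suc j)" if "m \<ge> 0" for m j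
  proof -
    note p = pow[OF that, of j]
    have "0 = L2_inner ?W (\<lambda>z. \<theta> z ^ j * z powi m)"
      using H2_orthogonal[OF p W W0] L2_inner_commute[of ?W "\<lambda>z. \<theta> z ^ j * z powi m"] by simp
    also have "\<dots> = A m j - t * L2_inner (\<lambda>z. cnj (\<theta> z) * G z) (\<lambda>z. \<theta> z ^ j * z powi m)"
      unfolding A_def L2_inner_diff_left[OF G L2_cmult[OF \<theta>G] H2_imp_L2[OF p]] L2_inner_cmult_left ..
    also have "L2_inner (\<lambda>z. cnj (\<theta> z) * G z) (\<lambda>z. \<theta> z ^ j * z powi m) = A m (Suc j)"
      unfolding A_def L2_inner_mult_left by (simp add: mult.assoc)
    finally show ?thesis by simp
  qed
  have iter: "A m 0 = t ^ j * A m j" if "m \<ge> 0" for m j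
  proof (induction j)
    case (Suc j)
    also have "t ^ j * A m j = t ^ Suc j * A m (Suc j)"
      by (subst step[OF that]) simp
    finally show ?case .
  qed simp
  \<comment> \<open>The test functions are unimodular a.e., so Cauchy-Schwarz gives a bound
    independent of \<open>j\<close>.\<close>
  have bound: "(cmod (A m j))\<^sup>2 \<le> sqnorm G" if "m \<ge> 0" for m j
  proof -
    have 1: "cmod (\<theta> z) = 1" if "cnj (\<theta> z) * \<theta> z = 1" for z
    proof -
      have "(cmod (\<theta> z))\<^sup>2 = 1"
        using arg_cong[OF that, of cmod] by (simp add: norm_mult power2_eq_square)
      then show ?thesis by (simp add: abs_square_eq_1)
    qed
    have "sqnorm (\<lambda>z. \<theta> z ^ j * z powi m) = (LINT z|circle. 1)"
      unfolding sqnorm_def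
    proof (rule integral_cong_AE)
      show "AE z in circle. (cmod (\<theta> z ^ j * z powi m))\<^sup>2 = 1"
        using \<theta>(4) AE_circle_cmod
        by eventually_elim (simp add: norm_mult norm_power norm_power_int 1)
    qed measurable
    then show ?thesis
      using L2_Cauchy_Schwarz[OF G H2_imp_L2[OF pow[OF that]], of j] by (simp add: A_def)
  qed
  have t: "cmod t < 1"
    unfolding t_def by (rule fourier_coeff_0_inner_function_less_1[OF assms(1,2)])
  have zero: "A m 0 = 0" if "m \<ge> 0" for m
  proof -
    have le: "cmod (A m 0) \<le> cmod t ^ j * sqrt (sqnorm G)" for j
    proof -
      have "cmod (A m j) \<le> sqrt (sqnorm G)"
        using bound[OF that] by (rule real_le_rsqrt)
      then show ?thesis
        unfolding iter[OF that, of j] norm_mult norm_power by (intro mult_left_mono) auto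
    qed
    have "(\<lambda>j. cmod t ^ j) \<longlonglongrightarrow> 0"
      using t by (intro LIMSEQ_power_zero) simp
    then have "(\<lambda>j. cmod t ^ j * sqrt (sqnorm G)) \<longlonglongrightarrow> 0"
      by (rule tendsto_mult_left_zero)
    then have "cmod (A m 0) \<le> 0"
      using le by (intro LIMSEQ_le_const) auto
    then show ?thesis by simp
  qed
  \<comment> \<open>A negative frequency \<open>n\<close> of \<open>f\<close> is the nonnegative
    frequency \<open>- n - 1\<close> of \<open>G\<close>.\<close>
  fix n :: int assume "n < 0"
  then have "A (- n - 1) 0 = 0"
    by (intro zero) simp
  then show "fourier_coeff f n = 0"
    using fourier_coeff_flip[OF fm, of "- n - 1"] by (simp add: A_def G_def fourier_coeff_def)
qed

section \<open>Symbols for which the restricted operators vanish\<close>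

theorem theorem2p3:
  fixes \<phi> \<eta> \<theta> :: "complex \<Rightarrow> complex"
  assumes "\<phi> \<in> Linf"
    and "inner_function \<eta>"
    and "inner_function \<theta>"
    and "\<not> ae_constant \<theta>"
  shows "(zero_operator_on (mult_set \<eta> H2) (restricted_toeplitz \<eta> \<theta> \<phi>)
            \<longleftrightarrow> \<phi> \<in> mult_set (\<lambda>z. cnj (\<eta> z) * \<theta> z) Hinf)
       \<and> (zero_operator_on (mult_set \<eta> H2) (restricted_hankel \<eta> \<theta> \<phi>)
            \<longleftrightarrow> \<phi> \<in> mult_set (\<lambda>z. cnj (\<eta> z)) Hinf)"
proof
  note \<eta> = inner_functionD[OF assms(2)] and \<theta> = inner_functionD[OF assms(3)]
  \<comment> \<open>Absorbing \<eta> into the symbol replaces the domain \<eta> \<open>H2\<close> by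
    \<open>H2\<close>.\<close>
  let ?f = "\<lambda>z. \<phi> z * \<eta> z"
  have f: "?f \<in> Linf"
    by (rule Linf_mult[OF assms(1) \<eta>(2)])
  note \<phi>m [measurable] = Linf_measurable[OF assms(1)] and fm = Linf_measurable[OF f]
  note \<theta>m [measurable] = Linf_measurable[OF \<theta>(2)] and \<eta>m [measurable] = Linf_measurable[OF \<eta>(2)]
  \<comment> \<open>The forward implications test the operators on these elements of the domain
    only.\<close>
  have h_powi: "(\<lambda>z. \<eta> z * z powi n) \<in> mult_set \<eta> H2" if "n \<ge> 0" for n
    by (rule mult_in_mult_set[OF \<eta>(2) H2_powi[OF that]])
  have h_eq: "\<exists>g\<in>H2. AE z in circle. \<phi> z * h z = ?f z * g z" if h: "h \<in> mult_set \<eta> H2" for h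
  proof -
    obtain g where "g \<in> H2" "AE z in circle. h z = \<eta> z * g z"
      using h by (auto simp: mult_set_def)
    then show ?thesis by (intro bexI[of _ g]) auto
  qed
  have h_L2: "(\<lambda>z. \<phi> z * h z) \<in> L2" if "h \<in> mult_set \<eta> H2" for h
    by (rule Linf_mult_L2[OF assms(1) mult_set_L2[OF \<eta>(2) that]])
  have fH: "(\<lambda>z. ?f z * g z) \<in> L2" if "g \<in> H2" for g
    by (rule Linf_mult_L2[OF f H2_imp_L2[OF that]])

  show "zero_operator_on (mult_set \<eta> H2) (restricted_toeplitz \<eta> \<theta> \<phi>)
            \<longleftrightarrow> \<phi> \<in> mult_set (\<lambda>z. cnj (\<eta> z) * \<theta> z) Hinf" (is "?Z \<longleftrightarrow> ?M")
  proof -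
    let ?u = "\<lambda>z. cnj (\<eta> z) * \<theta> z"
    have "AE z in circle. cnj (?u z) * ?u z = 1"
      using \<eta>(4) \<theta>(4)
    proof eventually_elim
      case (elim z)
      have "cnj (?u z) * ?u z = (cnj (\<eta> z) * \<eta> z) * (cnj (\<theta> z) * \<theta> z)"
        by simp
      then show ?case by (simp only: elim mult_1_left)
    qed
    then have "?M \<longleftrightarrow> (\<lambda>z. cnj (?u z) * \<phi> z) \<in> H2"
      by (rule mult_set_Hinf_iff[OF assms(1) Linf_mult[OF Linf_cnj[OF \<eta>(2)] \<theta>(2)]])
    \<comment> \<open>This brings the symbol condition into the form of the conclusion of
      \<open>toeplitz_vanishing_imp_H2\<close>.\<close>
    also have "(\<lambda>z. cnj (?u z) * \<phi> z) = (\<lambda>z. cnj (\<theta> z) * ?f z)"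
      by (simp add: mult_ac)
    finally have M: "?M \<longleftrightarrow> (\<lambda>z. cnj (\<theta> z) * ?f z) \<in> H2" .
    show ?thesis
      unfolding M zero_restricted_toeplitz_iff[OF assms(1) \<eta>(2) assms(3)]
    proof safe
      assume ortho: "\<forall>h\<in>mult_set \<eta> H2. \<forall>k\<in>model_space \<theta>. L2_inner (\<lambda>z. \<phi> z * h z) k = 0"
      show "(\<lambda>z. cnj (\<theta> z) * ?f z) \<in> H2"
      proof (rule toeplitz_vanishing_imp_H2[OF assms(3,4) f])
        fix n :: int and k assume "n \<ge> 0" "k \<in> model_space \<theta>"
        then show "L2_inner (\<lambda>z. ?f z * z powi n) k = 0"
          using ortho[rule_format, OF h_powi] by (simp add: mult.assoc)
      qed
    next
      \<comment> \<open>Conversely, \<phi> \<open>h\<close> agrees a.e. with \<theta> times an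
        element of \<open>H2\<close>, hence is orthogonal to the model space.\<close>
      fix h k
      assume H2: "(\<lambda>z. cnj (\<theta> z) * ?f z) \<in> H2" and h: "h \<in> mult_set \<eta> H2" and k: "k \<in> model_space \<theta>"
      obtain g where g: "g \<in> H2" "AE z in circle. \<phi> z * h z = ?f z * g z"
        using h_eq[OF h] by blast
      have "(\<lambda>z. cnj (\<theta> z) * ?f z) \<in> Hinf"
        using H2 Linf_mult[OF Linf_cnj[OF \<theta>(2)] f] by (simp add: Hinf_def)
      then have w: "(\<lambda>z. cnj (\<theta> z) * ?f z * g z) \<in> H2"
        by (rule Hinf_mult_H2[OF _ g(1)])
      have "AE z in circle. \<phi> z * h z = \<theta> z * (cnj (\<theta> z) * ?f z * g z)"
        using g(2) \<theta>(4)
      proof eventually_elim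
        case (elim z)
        have "\<theta> z * (cnj (\<theta> z) * ?f z * g z) = (cnj (\<theta> z) * \<theta> z) * (?f z * g z)"
          by (simp only: mult_ac)
        then show ?case by (simp only: elim mult_1_left)
      qed
      then have "L2_inner (\<lambda>z. \<phi> z * h z) k = L2_inner (\<lambda>z. \<theta> z * (cnj (\<theta> z) * ?f z * g z)) k"
        by (intro L2_inner_cong_AE L2_measurable h_L2 h Linf_mult_L2[OF \<theta>(2)] H2_imp_L2[OF w]
            H2_imp_L2[OF model_space_imp_H2[OF k]]) auto
      also have "\<dots> = 0"
        using model_spaceD[OF \<theta>(2) k w] L2_inner_commute[of _ k] by simp
      finally show "L2_inner (\<lambda>z. \<phi> z * h z) k = 0" .
    qed
  qed

  show "zero_operator_on (mult_set \<eta> H2) (restricted_hankel \<eta> \<theta> \<phi>)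
            \<longleftrightarrow> \<phi> \<in> mult_set (\<lambda>z. cnj (\<eta> z)) Hinf" (is "?Z \<longleftrightarrow> ?M")
  proof -
    have "AE z in circle. cnj (cnj (\<eta> z)) * cnj (\<eta> z) = 1"
      using \<eta>(4) by (simp add: mult.commute)
    then have "?M \<longleftrightarrow> (\<lambda>z. cnj (cnj (\<eta> z)) * \<phi> z) \<in> H2"
      by (rule mult_set_Hinf_iff[OF assms(1) Linf_cnj[OF \<eta>(2)]])
    also have "(\<lambda>z. cnj (cnj (\<eta> z)) * \<phi> z) = ?f"
      by (simp add: mult.commute)
    finally have M: "?M \<longleftrightarrow> ?f \<in> H2" .
    show ?thesis
      unfolding M zero_restricted_hankel_iff[OF assms(1) \<eta>(2) assms(3)]
    proof safe
      assume ortho: "\<forall>h\<in>mult_set \<eta> H2. \<forall>k\<in>model_space \<theta>. L2_inner (flip (\<lambda>z. \<phi> z * h z)) k = 0"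
      show "?f \<in> H2"
      proof (rule hankel_vanishing_imp_H2[OF assms(3,4) f])
        fix n :: int and k assume "n \<ge> 0" "k \<in> model_space \<theta>"
        then show "L2_inner (flip (\<lambda>z. ?f z * z powi n)) k = 0"
          using ortho[rule_format, OF h_powi] by (simp add: mult.assoc)
      qed
    next
      \<comment> \<open>Conversely, \<phi> \<open>h\<close> agrees a.e. with an element of
        \<open>H2\<close>, so its flip has only negative frequencies and is orthogonal to the model
        space, which lies in \<open>H2\<close>.\<close>
      fix h k
      assume H2: "?f \<in> H2" and h: "h \<in> mult_set \<eta> H2" and k: "k \<in> model_space \<theta>"
      obtain g where g: "g \<in> H2" "AE z in circle. \<phi> z * h z = ?f z * g z"
        using h_eq[OF h] by blast
      have w: "(\<lambda>z. ?f z * g z) \<in> H2"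
        using H2 f by (intro Hinf_mult_H2 g(1)) (simp add: Hinf_def)
      note F = flip_L2[OF h_L2[OF h]] and kH2 = model_space_imp_H2[OF k]
      have "L2_inner k (flip (\<lambda>z. \<phi> z * h z)) = 0"
      proof (rule H2_orthogonal[OF kH2 F])
        fix n :: int assume "n \<ge> 0"
        then show "fourier_coeff (flip (\<lambda>z. \<phi> z * h z)) n = 0"
          using H2_coeff[OF w, of "- n - 1"]
            fourier_coeff_cong_AE[OF L2_measurable[OF h_L2[OF h]] L2_measurable[OF H2_imp_L2[OF w]] g(2), of "- n - 1"]
          by (simp add: fourier_coeff_flip[OF L2_measurable[OF h_L2[OF h]]])
      qed
      then show "L2_inner (flip (\<lambda>z. \<phi> z * h z)) k = 0"
        using L2_inner_commute[of "flip (\<lambda>z. \<phi> z * h z)" k] by simp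
    qed
  qed
qed

end
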